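(* Let $\boldsymbol{k}=(k_1,\ldots,k_r)$ be an admissible index and let $s\in\mathbb{C}$ satisfy $$\max_{1\leq j\leq r}\{r-2j+2-(k_j+\cdots+k_r)\}<\Re(s)<0.$$ Then $$I_{\boldsymbol{k}}(s)=-\frac{\sin(\pi s)}{\pi}\sum_{0<n_1<\cdots<n_r}\frac{1}{n_1^{k_1-1}\cdots n_r^{k_r-1}}\int_0^\infty\frac{w^{-s-1}}{(w+n_1)\cdots(w+n_r)}\,dw.$$
   Context: An index $(k_1,\ldots,k_r)$ of positive integers is admissible if $k_r\ge 2$. For an admissible index $\boldsymbol{k}=(k_1,\ldots,k_r)$ the Ohno function is defined for $\Re(s)>-1$ by $$I_{\boldsymbol{k}}(s):=\sum_{i=1}^{r}\ \sum_{0<n_1<\cdots<n_r} \frac{1}{n_1^{k_1}\cdots n_r^{k_r}}\cdot \frac{1}{n_i^{s}} \prod_{\substack{1\le j\le r\\ j\ne i}} \frac{n_j}{ n_j-n_i },$$ where the $n_j$ run over integers, and it is continued meromorphically to $s\in\mathbb{C}$.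
   Formalization: The condition Re(s) > -r is added to the stated range, because for Re(s) ≤ -r every integral on the right-hand side diverges (e.g. r=1, k=(3), s=-3/2); absolute convergence of the integrals and of the sum is also proved. *)

theory Defs
  imports "HOL-Complex_Analysis.Complex_Analysis"
begin

text \<open>
  An index \<open>(k\<^sub>1, \<dots>, k\<^sub>r)\<close> is a list \<open>k\<close> of length \<open>r\<close>; since lists are indexed from \<open>0\<close>,
  \<open>k\<^sub>j\<close> is \<open>k ! (j - 1)\<close>.
\<close>

definition admissible :: "nat list \<Rightarrow> bool" where
  "admissible k \<longleftrightarrow> k \<noteq> [] \<and> (\<forall>x\<in>set k. 1 \<le> x) \<and> 2 \<le> last k"

definition increasing_tuples :: "nat \<Rightarrow> nat list set" where
  "increasing_tuples r = {n. length n = r \<and> sorted_wrt (<) n \<and> (\<forall>x\<in>set n. 0 < x)}"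

definition ohno_series :: "nat list \<Rightarrow> complex \<Rightarrow> complex" where
  "ohno_series k s =
     (\<Sum>i<length k. \<Sum>\<^sub>\<infinity>n\<in>increasing_tuples (length k).
        1 / (\<Prod>j<length k. of_nat (n ! j) ^ (k ! j)) * (1 / of_nat (n ! i) powr s) *
        (\<Prod>j\<in>{..<length k} - {i}. of_nat (n ! j) / (of_nat (n ! j) - of_nat (n ! i))))"

text \<open>
  A meromorphic continuation of the series from \<open>Re w > -1\<close> to the half-plane \<open>Re w > a\<close>.
  The word \<open>nicely\<close> fixes the values on the exceptional set: \<open>F\<close> takes its limit at every
  removable singularity (and the value \<open>0\<close> at poles).
\<close>

definition ohno_continuation :: "nat list \<Rightarrow> real \<Rightarrow> (complex \<Rightarrow> complex) \<Rightarrow> bool" where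
  "ohno_continuation k a F \<longleftrightarrow> a \<le> -1 \<and> F nicely_meromorphic_on {w. a < Re w} \<and>
     (\<forall>w. -1 < Re w \<longrightarrow> F w = ohno_series k w)"

text \<open>
  The value at \<open>s\<close> of the continued function, computed from a continuation to any half-plane
  containing \<open>s\<close>. Such continuations agree at \<open>s\<close> (lemma \<open>ohno_continuation_unique\<close>), and a
  continuation to all of \<open>\<complex>\<close> is equal to this function (lemma \<open>ohno_function_eq_global\<close>).
\<close>

definition ohno_function :: "nat list \<Rightarrow> complex \<Rightarrow> complex" where
  "ohno_function k s = (THE z. \<exists>a F. a < Re s \<and> ohno_continuation k a F \<and> z = F s)"

definition ohno_integrand :: "nat list \<Rightarrow> complex \<Rightarrow> real \<Rightarrow> complex" where
  "ohno_integrand n s w = of_real w powr (- s - 1) / (\<Prod>j<length n. of_real w + of_nat (n ! j))"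

lemma nicely_meromorphic_eq:
  assumes F: "F nicely_meromorphic_on A" and G: "G nicely_meromorphic_on A"
    and A: "open A" "connected A"
    and B: "open B" "B \<subseteq> A" "B \<noteq> {}" "\<And>w. w \<in> B \<Longrightarrow> F w = G w"
    and s: "s \<in> A"
  shows "F s = G s"
proof -
  define D where "D = remove_sings (\<lambda>w. F w - G w)"
  have mero: "(\<lambda>w. F w - G w) meromorphic_on A"
    using F G by (auto simp: nicely_meromorphic_on_def intro!: meromorphic_intros)
  have nD: "D nicely_meromorphic_on A"
    unfolding D_def by (rule remove_sings_nicely_meromorphic[OF mero])
  obtain b where b: "b \<in> B" using B by auto
  have Dz: "D x = 0" if "x \<in> B" for x
  proof -
    have "eventually (\<lambda>w. F w - G w = 0) (at x)"
      using eventually_at_in_open'[OF B(1) that] by eventually_elim (use B in auto)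
    hence "remove_sings (\<lambda>w. F w - G w) x = remove_sings (\<lambda>_. 0) x"
      by (intro remove_sings_cong) auto
    thus ?thesis by (simp add: D_def)
  qed
  have "eventually (\<lambda>w. D w = 0) (at b)"
    using eventually_at_in_open'[OF B(1) b] by eventually_elim (use Dz in auto)
  hence "frequently (\<lambda>w. D w = 0) (at b)"
    by (intro eventually_frequently) auto
  hence D0: "D w = 0" if "w \<in> A" for w
    using frequently_eq_meromorphic_imp_constant[OF _ nD A, of 0 b] b B(2) that by blast
  have "eventually (\<lambda>w. D w = F w - G w) (at s)"
    unfolding D_def
    by (rule eventually_remove_sings_eq_at)
       (use mero s in \<open>auto intro!: meromorphic_on_isolated_singularity simp: meromorphic_on_altdef\<close>)
  moreover have "eventually (\<lambda>w. w \<in> A) (at s)"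
    using A(1) s by (rule eventually_at_in_open')
  ultimately have ev: "eventually (\<lambda>w. F w = G w) (at s)"
    by eventually_elim (use D0 in auto)
  have pole: "is_pole F s \<longleftrightarrow> is_pole G s"
    using ev by (intro is_pole_cong) auto
  show ?thesis
  proof (cases "is_pole F s")
    case True
    have "\<not> H \<midarrow>s\<rightarrow> H s" if "is_pole H s" for H :: "complex \<Rightarrow> complex"
      using that not_tendsto_and_filterlim_at_infinity[of "at s" H "H s"]
      by (auto simp: is_pole_def)
    with True pole F G s show ?thesis
      unfolding nicely_meromorphic_on_def by metis
  next
    case False
    with pole F G s have lim: "F \<midarrow>s\<rightarrow> F s" "G \<midarrow>s\<rightarrow> G s"
      by (auto simp: nicely_meromorphic_on_def)
    have "G \<midarrow>s\<rightarrow> F s"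
      by (rule Lim_transform_eventually[OF lim(1) ev])
    thus ?thesis
      using lim(2) by (rule LIM_unique)
  qed
qed

lemma ohno_continuation_unique:
  assumes F: "ohno_continuation k a F" "a < Re s" and G: "ohno_continuation k b G" "b < Re s"
  shows "F s = G s"
proof (rule nicely_meromorphic_eq[of F "{w. max a b < Re w}" G "{w. -1 < Re w}" s])
  show "F nicely_meromorphic_on {w. max a b < Re w}"
    by (rule nicely_meromorphic_on_subset[of _ "{w. a < Re w}"])
       (use F in \<open>auto simp: ohno_continuation_def\<close>)
  show "G nicely_meromorphic_on {w. max a b < Re w}"
    by (rule nicely_meromorphic_on_subset[of _ "{w. b < Re w}"])
       (use G in \<open>auto simp: ohno_continuation_def\<close>)
  show "open {w. max a b < Re w}"
    by (rule open_halfspace_Re_gt)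
  show "connected {w. max a b < Re w}"
    by (intro convex_connected convex_halfspace_Re_gt)
  show "{w. -1 < Re w} \<noteq> {}"
    by (auto intro!: exI[of _ 0])
qed (use F G in \<open>auto simp: ohno_continuation_def intro!: open_halfspace_Re_gt\<close>)

lemma ohno_function_eq:
  assumes "ohno_continuation k a F" "a < Re s"
  shows "ohno_function k s = F s"
  unfolding ohno_function_def
  by (rule the_equality) (use assms ohno_continuation_unique in blast)+

lemma ohno_function_eq_global:
  assumes "F nicely_meromorphic_on UNIV" "\<And>w. -1 < Re w \<Longrightarrow> F w = ohno_series k w"
  shows "ohno_function k = F"
proof
  fix s
  have "ohno_continuation k (min (-1) (Re s - 1)) F"
    using assms by (auto simp: ohno_continuation_def intro: nicely_meromorphic_on_subset)
  thus "ohno_function k s = F s" by (rule ohno_function_eq) auto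
qed

text \<open>
  At infinity the integrand has modulus of order \<open>w powr (- Re s - 1 - r)\<close> for a tuple of length
  \<open>r\<close>, so the integral of \<open>ohno_integrand n s\<close> over the positive reals converges only if
  \<open>- r < Re s\<close>. This is the value \<open>- r\<close> that \<open>r - 2 j + 2 - (k\<^sub>j + \<dots> + k\<^sub>r)\<close> takes at \<open>j = r + 1\<close>,
  and it does not follow from the bounds for \<open>1 \<le> j \<le> r\<close>: for \<open>k = (3)\<close> they only give \<open>-2 < Re s\<close>.
\<close>

lemma not_integrable_ohno_integrand:
  assumes "Re s \<le> - real (length n)"
  shows "\<not> set_integrable lborel {0<..} (ohno_integrand n s)"
proof
  assume int: "set_integrable lborel {0<..} (ohno_integrand n s)"
  define r where "r = length n"
  define N where "N = 1 + real (sum_list n)"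
  have N1: "N \<ge> 1" by (simp add: N_def)
  have nN: "real (n ! j) \<le> N" if "j < r" for j
  proof -
    have "n ! j \<le> sum_list n"
      using that by (intro member_le_sum_list) (auto simp: r_def)
    thus ?thesis by (simp add: N_def)
  qed
  define c where "c = (1 / 2 ^ r :: real)"
  have lower: "c / w \<le> norm (ohno_integrand n s w)" if w: "w \<ge> N" for w
  proof -
    have w1: "w \<ge> 1" using w N1 by linarith
    have nn: "norm (of_real w + of_nat (n ! j) :: complex) = w + real (n ! j)" for j
    proof -
      have "(of_real w + of_nat (n ! j) :: complex) = of_real (w + real (n ! j))" by simp
      thus ?thesis using w1 by (simp only: norm_of_real)
    qed
    have pr: "(\<Prod>j<r. w + real (n ! j)) \<le> (\<Prod>j<r. 2 * w)"
      by (intro prod_mono) (use nN w w1 in \<open>auto intro: order_trans\<close>)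
    have prpos: "(\<Prod>j<r. w + real (n ! j)) > 0"
      by (intro prod_pos) (use w1 in auto)
    have "norm (of_real w powr (- s - 1) :: complex) = w powr (- Re s - 1)"
      using w1 by (simp add: norm_powr_real_powr)
    moreover have "w powr (- Re s - 1) \<ge> w powr (real r - 1)"
      using assms w1 by (intro powr_mono) (auto simp: r_def)
    moreover have "w powr (real r - 1) = w ^ r / w"
      using w1 by (simp add: powr_diff powr_realpow)
    ultimately have "norm (of_real w powr (- s - 1) :: complex) \<ge> w ^ r / w" by simp
    hence "(w ^ r / w) / (\<Prod>j<r. 2 * w) \<le> norm (of_real w powr (- s - 1) :: complex) / (\<Prod>j<r. w + real (n ! j))"
      using pr prpos w1 by (intro frac_le) auto
    also have "(w ^ r / w) / (\<Prod>j<r. 2 * w) = c / w"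
      using w1 by (simp add: c_def power_mult_distrib)
    finally show ?thesis
      by (simp add: ohno_integrand_def norm_divide nn flip: r_def prod_norm)
  qed
  have int': "set_integrable lborel {N..} (\<lambda>w. norm (ohno_integrand n s w))"
    using set_integrable_norm[OF set_integrable_subset[OF int, of "{N..}"]] N1 by force
  define I where "I = (LINT w:{N..}|lborel. norm (ohno_integrand n s w))"
  have bound: "c * (ln M - ln N) \<le> I" if M: "M \<ge> N" for M
  proof -
    have h: "((\<lambda>w. c / w) has_integral (c * ln M - c * ln N)) {N..M}"
      by (rule fundamental_theorem_of_calculus[OF M])
         (use N1 in \<open>auto intro!: derivative_eq_intros
            simp flip: has_real_derivative_iff_has_vector_derivative\<close>)
    have si: "set_integrable lborel {N..M} (\<lambda>w. c / w)"
      unfolding set_integrable_def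
      by (intro borel_integrable_compact continuous_intros) (use N1 in auto)
    have "c * ln M - c * ln N = (LINT w:{N..M}|lborel. c / w)"
      using integral_unique[OF h] set_borel_integral_eq_integral(2)[OF si] by simp
    also have "\<dots> \<le> (LINT w:{N..M}|lborel. norm (ohno_integrand n s w))"
      by (rule set_integral_mono[OF si set_integrable_subset[OF int']]) (use lower in auto)
    also have "\<dots> \<le> I"
      unfolding I_def set_lebesgue_integral_def
      using int' set_integrable_subset[OF int', of "{N..M}"]
      by (intro integral_mono) (auto simp: set_integrable_def indicator_def)
    finally show ?thesis by (simp add: algebra_simps)
  qed
  have c0: "c > 0" by (simp add: c_def)
  define M where "M = exp (ln N + (\<bar>I\<bar> + 1) / c)"
  have "M \<ge> exp (ln N)" unfolding M_def using c0 by simp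
  hence "M \<ge> N" using N1 by simp
  from bound[OF this] have "\<bar>I\<bar> + 1 \<le> I" using c0 by (simp add: M_def)
  thus False by linarith
qed
end

theory Submission
  imports Defs
begin

text \<open>
  Let \<open>r\<close> be the length of the index and let \<open>A\<close> be the larger of \<open>- r\<close> and the maximum in the theorem;
  it is at most \<open>-1\<close>, and is called \<open>abscissa k\<close> below. On \<open>-1 < Re s < 0\<close> the identity already holds tuple by tuple: the partial
  fraction expansion of \<open>1 / ((w + n\<^sub>1) \<dots> (w + n\<^sub>r))\<close> and the classical integral
  \<open>\<integral>\<^sub>0\<^sup>\<infinity> w powr (- s - 1) / (w + n) dw = - \<pi> n powr (- s - 1) / sin (\<pi> s)\<close>
  turn the integral of one tuple, multiplied by \<open>- sin (\<pi> s) / \<pi>\<close> and by the weight of the tuple, into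
  exactly the \<open>r\<close> summands that the Ohno series attaches to that tuple
  (lemma \<open>ohno_integral_partial_fractions\<close>). The Ohno series is holomorphic on \<open>Re s > -1\<close>, and the
  right-hand side is holomorphic on \<open>A < Re s < 0\<close>. Since the two agree on the overlap, they glue to a
  holomorphic function on \<open>Re s > A\<close>, which is the continuation of the Ohno function to that half-plane.

  What has to be proved is therefore absolute convergence, locally uniformly in \<open>s\<close>, in the two regions.

  For the Ohno series (lemma \<open>ohno_summand_bound\<close>), the \<open>i\<close>-th summand is at most
  \<open>n\<^sub>i powr (- \<eta>) / n\<^sub>r\<close> times the product of the \<open>1 / \<bar>n\<^sub>j - n\<^sub>i\<bar>\<close>, where \<open>\<eta> > 0\<close> and \<open>\<eta> \<le> 1 + Re s\<close>.
  Because \<open>n\<^sub>r\<close> dominates \<open>n\<^sub>i\<close> and all the differences, its reciprocal can be distributed over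
  them so that every factor gets an exponent below \<open>-1\<close>. A tuple is determined by \<open>n\<^sub>i\<close> and the
  differences, so the result is dominated by a product of convergent zeta series.

  For the integrals (lemmas \<open>exponent_shift_bound\<close> and \<open>integral_summand_majorant\<close>), each factor satisfies
  \<open>w + n \<ge> w powr \<theta> * n powr (1 - \<theta>)\<close> for \<open>\<theta> \<in> [0, 1]\<close>. A choice of one \<open>\<theta>\<^sub>j\<close> per factor gives decay
  \<open>w powr (- t)\<close> with \<open>t = \<theta>\<^sub>1 + \<dots> + \<theta>\<^sub>r\<close>, at the price of lowering the exponent of \<open>n\<^sub>j\<close> to \<open>k\<^sub>j - \<theta>\<^sub>j\<close>. The
  remaining multiple series converges if every tail \<open>j, \<dots>, r\<close> has exponent sum larger than its length.
  Hence it is best to spend \<open>t\<close> on the first factors, \<open>\<theta> = (1, \<dots>, 1, fractional part, 0, \<dots>, 0)\<close>, and the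
  resulting conditions on \<open>t\<close> hold for every \<open>t < - A\<close>. Convergence at infinity needs \<open>t > - Re s\<close>, so a
  suitable \<open>t\<close> exists when \<open>A < Re s\<close>.
\<close>


section \<open>Multiple series\<close>

lemma has_sum_finite_sum:
  fixes f :: "'i \<Rightarrow> 'a \<Rightarrow> 'b::{topological_comm_monoid_add, t2_space}"
  assumes "finite I" "\<And>i. i \<in> I \<Longrightarrow> f i summable_on A"
  shows "((\<lambda>x. \<Sum>i\<in>I. f i x) has_sum (\<Sum>i\<in>I. infsum (f i) A)) A"
  using assms by (induction I rule: finite_induct) (auto intro!: has_sum_add has_sum_infsum)

lemma summable_on_prod_lists:
  fixes f :: "'a \<Rightarrow> real"
  assumes "f summable_on A" "\<And>x. x \<in> A \<Longrightarrow> 0 \<le> f x"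
  shows "(\<lambda>xs. \<Prod>j<r. f (xs ! j)) summable_on {xs. length xs = r \<and> set xs \<subseteq> A}"
proof (induction r)
  case 0
  have "{xs. length xs = 0 \<and> set xs \<subseteq> A} = {[]}" by auto
  thus ?case by simp
next
  case (Suc r)
  define L where "L = {xs. length xs = r \<and> set xs \<subseteq> A}"
  define P where "P = (\<lambda>xs. \<Prod>j<r. f (xs ! j))"
  have "(\<lambda>(x, xs). f x * P xs) summable_on (A \<times> L)"
  proof (rule summable_on_SigmaI)
    show "((\<lambda>xs. case (x, xs) of (x, xs) \<Rightarrow> f x * P xs) has_sum (f x * infsum P L)) L" for x
      using has_sum_cmult_right[OF has_sum_infsum, of P L "f x"] Suc by (simp add: P_def L_def)
    show "(\<lambda>x. f x * infsum P L) summable_on A"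
      by (rule summable_on_cmult_left[OF assms(1)])
  qed (auto simp: P_def L_def intro!: mult_nonneg_nonneg prod_nonneg assms(2) dest: nth_mem)
  moreover have "(\<lambda>xs. \<Prod>j<Suc r. f (xs ! j)) \<circ> (\<lambda>(x, xs). x # xs) = (\<lambda>(x, xs). f x * P xs)"
    by (auto simp: P_def prod.lessThan_Suc_shift simp del: prod.lessThan_Suc)
  moreover have "inj_on (\<lambda>(x, xs). x # xs) (A \<times> L)"
    by (auto simp: inj_on_def)
  ultimately have "(\<lambda>xs. \<Prod>j<Suc r. f (xs ! j)) summable_on (\<lambda>(x, xs). x # xs) ` (A \<times> L)"
    by (simp only: summable_on_reindex)
  moreover have "(\<lambda>(x, xs). x # xs) ` (A \<times> L) = {xs. length xs = Suc r \<and> set xs \<subseteq> A}"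
    by (auto simp: L_def length_Suc_conv image_iff)
  ultimately show ?case by simp
qed

lemma summable_on_prod_powr:
  assumes "1 < a"
  shows "(\<lambda>n. \<Prod>j<r. real (n ! j) powr (- a)) summable_on {n. length n = r \<and> set n \<subseteq> {0<..}}"
proof (rule summable_on_prod_lists)
  have "(\<lambda>n. real n powr (- a)) summable_on UNIV"
    using assms by (subst summable_on_UNIV_nonneg_real_iff) (auto simp: summable_real_powr_iff)
  thus "(\<lambda>n. real n powr (- a)) summable_on {0<..}"
    by (rule summable_on_subset_banach) auto
qed auto

lemma increasing_tuples_subset: "increasing_tuples r \<subseteq> {n. length n = r \<and> set n \<subseteq> {0<..}}"
  by (auto simp: increasing_tuples_def)

lemma increasing_tuples_less:
  assumes "n \<in> increasing_tuples r" "i < j" "j < r"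
  shows "n ! i < n ! j"
  using assms by (auto simp: increasing_tuples_def sorted_wrt_iff_nth_less)

lemma increasing_tuples_mono:
  assumes "n \<in> increasing_tuples r" "i \<le> j" "j < r"
  shows "n ! i \<le> n ! j"
  using increasing_tuples_less[OF assms(1), of i j] assms by (cases "i = j") auto

lemma increasing_tuples_pos:
  assumes "n \<in> increasing_tuples r" "j < r"
  shows "0 < n ! j"
  using assms by (auto simp: increasing_tuples_def)

lemma increasing_tuples_inj:
  assumes "n \<in> increasing_tuples r"
  shows "inj_on (\<lambda>j. n ! j) {..<r}"
proof (rule inj_onI)
  fix i j assume "i \<in> {..<r}" "j \<in> {..<r}" "n ! i = n ! j"
  thus "i = j"
    using increasing_tuples_less[OF assms, of i j] increasing_tuples_less[OF assms, of j i]
    by (cases i j rule: linorder_cases) auto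
qed

section \<open>Holomorphic limits and Mellin integrals\<close>

lemma holomorphic_on_uniform_limit:
  assumes "open S" "uniform_limit S f g F" "F \<noteq> bot"
    and "eventually (\<lambda>n. f n holomorphic_on S) F"
  shows "g holomorphic_on S"
proof (rule analytic_imp_holomorphic, subst analytic_on_analytic_at, intro ballI)
  fix z assume "z \<in> S"
  then obtain r where r: "0 < r" "cball z r \<subseteq> S"
    using assms(1) open_contains_cball by blast
  have hol: "eventually (\<lambda>n. continuous_on (cball z r) (f n) \<and> f n holomorphic_on ball z r) F"
    using assms(4)
  proof eventually_elim
    case (elim n)
    hence "f n holomorphic_on cball z r" using r(2) by (rule holomorphic_on_subset)
    thus ?case
      by (auto intro: holomorphic_on_imp_continuous_on holomorphic_on_subset[OF _ ball_subset_cball])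
  qed
  have "uniform_limit (cball z r) f g F"
    using assms(2) r(2) by (rule uniform_limit_on_subset)
  then obtain "g holomorphic_on ball z r"
    using holomorphic_uniform_limit[OF hol _ assms(3)] by blast
  thus "g analytic_on {z}"
    using r(1) by (auto simp: analytic_at intro!: exI[of _ "ball z r"])
qed

lemma holomorphic_on_infsum:
  fixes f :: "'a \<Rightarrow> complex \<Rightarrow> complex"
  assumes "open S" "\<And>x. x \<in> X \<Longrightarrow> f x holomorphic_on S"
    and "\<And>x s. x \<in> X \<Longrightarrow> s \<in> S \<Longrightarrow> norm (f x s) \<le> B x" "B summable_on X"
  shows "(\<lambda>s. \<Sum>\<^sub>\<infinity>x\<in>X. f x s) holomorphic_on S"
proof (rule holomorphic_on_uniform_limit[OF assms(1)])
  show "uniform_limit S (\<lambda>A s. \<Sum>x\<in>A. f x s) (\<lambda>s. \<Sum>\<^sub>\<infinity>x\<in>X. f x s) (finite_subsets_at_top X)"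
    using assms(3,4) by (rule Weierstrass_m_test_general)
  show "eventually (\<lambda>A. (\<lambda>s. \<Sum>x\<in>A. f x s) holomorphic_on S) (finite_subsets_at_top X)"
    by (rule eventually_finite_subsets_at_top_weakI)
       (use assms(2) in \<open>auto intro!: holomorphic_on_sum\<close>)
qed simp

lemma open_strip: "open {s. a < Re s \<and> Re s < b}"
  using open_Int[OF open_halfspace_Re_gt open_halfspace_Re_lt, of a b] by (simp add: Int_def)

lemma convex_strip: "convex {s. a < Re s \<and> Re s < b}"
  using convex_Int[OF convex_halfspace_Re_gt convex_halfspace_Re_lt, of a b] by (simp add: Int_def)

lemma holomorphic_on_strip:
  assumes "\<And>a b. A < a \<Longrightarrow> a < b \<Longrightarrow> b < B \<Longrightarrow> f holomorphic_on {s. a < Re s \<and> Re s < b}"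
  shows "f holomorphic_on {s. A < Re s \<and> Re s < B}"
proof (rule analytic_imp_holomorphic, subst analytic_on_analytic_at, intro ballI)
  fix s assume "s \<in> {s. A < Re s \<and> Re s < B}"
  hence s: "A < Re s" "Re s < B" by auto
  obtain a b where ab: "A < a" "a < Re s" "Re s < b" "b < B"
    using dense[OF s(1)] dense[OF s(2)] by blast
  have "f holomorphic_on {s. a < Re s \<and> Re s < b}"
    using ab by (intro assms) auto
  thus "f analytic_on {s}"
    using ab open_strip[of a b] by (auto simp: analytic_at)
qed

lemma norm_powr_le_sum_powr:
  assumes "0 < w" "a \<le> Re s" "Re s \<le> b"
  shows "norm (of_real w powr (- s - 1) :: complex) \<le> w powr (- a - 1) + w powr (- b - 1)"
proof -
  have "norm (of_real w powr (- s - 1) :: complex) = w powr (- Re s - 1)"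
    using assms by (simp add: norm_powr_real_powr)
  also have "\<dots> \<le> w powr (- a - 1) + w powr (- b - 1)"
  proof (cases "w \<le> 1")
    case True
    hence "w powr (- Re s - 1) \<le> w powr (- b - 1)"
      using assms by (intro powr_mono') auto
    thus ?thesis by (simp add: add_increasing)
  next
    case False
    hence "w powr (- Re s - 1) \<le> w powr (- a - 1)"
      using assms by (intro powr_mono) auto
    thus ?thesis by (simp add: add_increasing2)
  qed
  finally show ?thesis .
qed

text \<open>
  The integrand is dominated on the whole strip by one integrable function, because the power of \<open>w\<close>
  is at most the sum of its values on the two boundary lines. Differentiation under the integral
  sign is elementary on the compact intervals \<open>[1 / (m + 1), m + 1]\<close>, and the dominating function makes the
  truncated integrals converge uniformly.
\<close>
lemma mellin_strip:
  fixes f :: "real \<Rightarrow> complex" and G :: "real \<Rightarrow> real"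
  assumes cont: "continuous_on {0<..} f"
    and bound: "\<And>w. 0 < w \<Longrightarrow> norm (f w) \<le> G w"
    and int: "set_integrable lborel {0<..} (\<lambda>w. (w powr (- a - 1) + w powr (- b - 1)) * G w)"
  shows mellin_integrable: "\<And>s. a \<le> Re s \<Longrightarrow> Re s \<le> b \<Longrightarrow>
          set_integrable lborel {0<..} (\<lambda>w. of_real w powr (- s - 1) * f w)"
    and mellin_norm_le: "\<And>s. a \<le> Re s \<Longrightarrow> Re s \<le> b \<Longrightarrow>
          norm (LBINT w:{0<..}. of_real w powr (- s - 1) * f w) \<le>
          (LBINT w:{0<..}. (w powr (- a - 1) + w powr (- b - 1)) * G w)"
    and mellin_holomorphic: "(\<lambda>s. LBINT w:{0<..}. of_real w powr (- s - 1) * f w)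
          holomorphic_on {s. a < Re s \<and> Re s < b}"
proof -
  define g where "g = (\<lambda>w. (w powr (- a - 1) + w powr (- b - 1)) * G w)"
  have int_g: "set_integrable lborel {0<..} g" using int by (simp add: g_def)
  have le_g: "norm (of_real w powr (- s - 1) * f w) \<le> g w"
    if "0 < w" "a \<le> Re s" "Re s \<le> b" for w s
    using norm_powr_le_sum_powr[OF that] bound[OF that(1)]
    unfolding g_def norm_mult by (intro mult_mono) auto
  have cont_integrand: "continuous_on {0<..} (\<lambda>w. of_real w powr (- s - 1) * f w)" for s
    by (intro continuous_intros cont) (auto simp: complex_nonpos_Reals_iff)
  have integrable: "set_integrable lborel {0<..} (\<lambda>w. of_real w powr (- s - 1) * f w)"
    if "a \<le> Re s" "Re s \<le> b" for s
    using int_g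
  proof (rule set_integrable_bound)
    show "set_borel_measurable lborel {0<..} (\<lambda>w. of_real w powr (- s - 1) * f w)"
      using borel_measurable_continuous_on_indicator[OF _ cont_integrand]
      by (simp add: set_borel_measurable_def)
  qed (use le_g that in \<open>auto intro!: AE_I2 order_trans[OF _ abs_ge_self]\<close>)
  thus "\<And>s. a \<le> Re s \<Longrightarrow> Re s \<le> b \<Longrightarrow>
          set_integrable lborel {0<..} (\<lambda>w. of_real w powr (- s - 1) * f w)" .
  have norm_le: "norm (LBINT w:A. of_real w powr (- s - 1) * f w) \<le> (LBINT w:A. g w)"
    if s: "a \<le> Re s" "Re s \<le> b" and A: "A \<in> sets borel" "A \<subseteq> {0<..}" for s A
  proof -
    have int_A: "set_integrable lborel A (\<lambda>w. of_real w powr (- s - 1) * f w)"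
      using set_integrable_subset[OF integrable[OF s]] A by simp
    have "norm (LBINT w:A. of_real w powr (- s - 1) * f w) \<le>
        (LBINT w:A. norm (of_real w powr (- s - 1) * f w))"
      by (rule set_integral_norm_bound[OF int_A])
    also have "\<dots> \<le> (LBINT w:A. g w)"
      by (rule set_integral_mono)
         (use int_A set_integrable_subset[OF int_g] A le_g s in \<open>auto intro: set_integrable_norm\<close>)
    finally show ?thesis .
  qed
  show "norm (LBINT w:{0<..}. of_real w powr (- s - 1) * f w) \<le>
          (LBINT w:{0<..}. (w powr (- a - 1) + w powr (- b - 1)) * G w)"
    if "a \<le> Re s" "Re s \<le> b" for s
    using norm_le[OF that, of "{0<..}"] by (simp add: g_def)

  define S where "S = {s. a < Re s \<and> Re s < b}"
  have S: "open S" "convex S" by (simp_all add: S_def open_strip convex_strip)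
  define K where "K = (\<lambda>m::nat. {1 / real (m + 1)..real (m + 1)})"
  have K: "K m \<subseteq> {0<..}" for m
    by (auto simp: K_def intro: less_le_trans[of 0 "1 / real (m + 1)"])
  define F where "F = (\<lambda>m s. LBINT w:K m. of_real w powr (- s - 1) * f w)"
  have hol_F: "F m holomorphic_on S" for m
  proof -
    define h where "h = (\<lambda>s w. exp ((- s - 1) * of_real (ln w)) * f w)"
    have pos: "0 < w" if "w \<in> cbox (1 / real (m + 1)) (real (m + 1))" for w
      using that K[of m] by (auto simp: K_def)
    have h: "of_real w powr (- s - 1) * f w = h s w" if "0 < w" for s w
      using that by (simp add: h_def powr_def Ln_of_real)
    have contf: "continuous_on (cbox (1 / real (m + 1)) (real (m + 1))) f"
      using cont by (rule continuous_on_subset) (use pos in auto)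
    have "(\<lambda>s. integral (cbox (1 / real (m + 1)) (real (m + 1))) (h s)) holomorphic_on S"
    proof (rule leibniz_rule_holomorphic[OF _ _ _ S(2)])
      show "((\<lambda>s. h s w) has_field_derivative - of_real (ln w) * h s w) (at s within S)" for s w
        unfolding h_def by (auto intro!: derivative_eq_intros)
      show "h s integrable_on cbox (1 / real (m + 1)) (real (m + 1))" for s
        unfolding h_def
        by (intro integrable_continuous continuous_intros contf) (use pos in force)+
      have "continuous_on (S \<times> cbox (1 / real (m + 1)) (real (m + 1))) (\<lambda>x. f (snd x))"
        by (rule continuous_on_compose2[OF contf]) (auto intro!: continuous_intros)
      thus "continuous_on (S \<times> cbox (1 / real (m + 1)) (real (m + 1)))
          (\<lambda>(s, w). - of_real (ln w) * h s w)"
        unfolding h_def case_prod_beta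
        by (intro continuous_intros) (use pos in force)+
    qed
    moreover have "integral (cbox (1 / real (m + 1)) (real (m + 1))) (h s) = F m s" if "s \<in> S" for s
    proof -
      have "set_integrable lborel (K m) (\<lambda>w. of_real w powr (- s - 1) * f w)"
        using that by (intro set_integrable_subset[OF integrable _ K]) (auto simp: S_def K_def)
      hence "F m s = integral (K m) (\<lambda>w. of_real w powr (- s - 1) * f w)"
        unfolding F_def by (rule set_borel_integral_eq_integral)
      also have "\<dots> = integral (K m) (h s)"
        using K[of m] by (intro Henstock_Kurzweil_Integration.integral_cong h) auto
      finally show ?thesis by (simp add: K_def)
    qed
    ultimately show ?thesis by (simp cong: holomorphic_cong)
  qed
  have "(\<lambda>s. LBINT w:{0<..}. of_real w powr (- s - 1) * f w) holomorphic_on S"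
  proof (rule holomorphic_on_uniform_limit[OF S(1)])
    show "sequentially \<noteq> bot" by simp
    show "eventually (\<lambda>m. F m holomorphic_on S) sequentially"
      using hol_F by (rule always_eventually[OF allI])
    define t where "t = (\<lambda>m. LBINT w:{0<..} - K m. g w)"
    have "t \<longlonglongrightarrow> (LBINT (w::real). 0)"
      unfolding t_def set_lebesgue_integral_def
    proof (rule integral_dominated_convergence)
      show "integrable lborel (\<lambda>w. norm (indicator {0<..} w *\<^sub>R g w))"
        using int_g unfolding set_integrable_def by (rule integrable_norm)
      show "(\<lambda>w. indicat_real ({0<..} - K m) w *\<^sub>R g w) \<in> borel_measurable lborel" for m
        using set_integrable_subset[OF int_g, of "{0<..} - K m"]
        by (auto simp: K_def set_integrable_def)
      show "AE w in lborel. (\<lambda>m. indicat_real ({0<..} - K m) w *\<^sub>R g w) \<longlonglongrightarrow> 0"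
      proof (intro AE_I2)
        fix w :: real
        show "(\<lambda>m. indicat_real ({0<..} - K m) w *\<^sub>R g w) \<longlonglongrightarrow> 0"
        proof (cases "0 < w")
          case True
          obtain N :: nat where N: "w + 1 / w \<le> real N" using real_arch_simple by blast
          have "w \<in> K m" if "m \<ge> N" for m
          proof -
            have "real N \<le> real m" using that by simp
            hence "1 / w \<le> real (m + 1)" "w \<le> real (m + 1)"
              using N True by (auto intro: order_trans[of _ "w + 1 / w"])
            thus ?thesis using True by (auto simp: K_def field_simps)
          qed
          hence "eventually (\<lambda>m. indicat_real ({0<..} - K m) w *\<^sub>R g w = 0) sequentially"
            by (intro eventually_sequentiallyI[of N]) auto
          thus ?thesis by (rule tendsto_eventually)
        qed simp
      qed
    qed (auto simp: indicator_def)
    hence t0: "t \<longlonglongrightarrow> 0" by simp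
    show "uniform_limit S F (\<lambda>s. LBINT w:{0<..}. of_real w powr (- s - 1) * f w) sequentially"
    proof (rule uniform_limitI)
      fix e :: real assume "0 < e"
      hence "eventually (\<lambda>m. t m < e) sequentially"
        using order_tendstoD(2)[OF t0] by blast
      thus "eventually (\<lambda>m. \<forall>s\<in>S. dist (F m s) (LBINT w:{0<..}. of_real w powr (- s - 1) * f w) < e)
          sequentially"
      proof eventually_elim
        case (elim m)
        show ?case
        proof
          fix s assume s: "s \<in> S"
          have meas: "K m \<in> sets borel" "{0<..} - K m \<in> sets borel" by (auto simp: K_def)
          have int_s: "set_integrable lborel {0<..} (\<lambda>w. of_real w powr (- s - 1) * f w)"
            using s by (intro integrable) (auto simp: S_def)
          have "(LBINT w:K m \<union> ({0<..} - K m). of_real w powr (- s - 1) * f w) =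
              F m s + (LBINT w:{0<..} - K m. of_real w powr (- s - 1) * f w)"
            unfolding F_def
            by (rule set_integral_Un) (use set_integrable_subset[OF int_s] meas K[of m] in auto)
          moreover have "K m \<union> ({0<..} - K m) = {0<..}" using K[of m] by auto
          ultimately have "dist (F m s) (LBINT w:{0<..}. of_real w powr (- s - 1) * f w) =
              norm (LBINT w:{0<..} - K m. of_real w powr (- s - 1) * f w)"
            by (simp add: dist_norm)
          also have "\<dots> \<le> t m"
            unfolding t_def by (rule norm_le) (use s meas in \<open>auto simp: S_def\<close>)
          finally show "dist (F m s) (LBINT w:{0<..}. of_real w powr (- s - 1) * f w) < e"
            using elim by simp
        qed
      qed
    qed
  qed
  thus "(\<lambda>s. LBINT w:{0<..}. of_real w powr (- s - 1) * f w)
      holomorphic_on {s. a < Re s \<and> Re s < b}" by (simp add: S_def)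
qed

lemma set_integrable_lborel_of_nonneg:
  fixes f :: "real \<Rightarrow> real"
  assumes "f integrable_on A" "\<And>x. x \<in> A \<Longrightarrow> 0 \<le> f x" "f \<in> borel_measurable borel" "A \<in> sets borel"
  shows "set_integrable lborel A f"
proof -
  have "f absolutely_integrable_on A"
    using assms by (intro nonnegative_absolutely_integrable_1)
  moreover have "(\<lambda>x. indicat_real A x *\<^sub>R f x) \<in> borel_measurable lborel"
    using assms by measurable
  ultimately show ?thesis by (simp add: set_integrable_def integrable_completion)
qed

text \<open>
  Near \<open>0\<close> the integrand is \<open>w powr (- c - 1)\<close>, near infinity it is \<open>w powr (- c - 1 - t)\<close>; the two
  hypotheses are the integrability conditions at these two ends.
\<close>
lemma set_integrable_powr_min:
  fixes c t :: real
  assumes "c < 0" "- t < c"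
  shows "set_integrable lborel {0<..} (\<lambda>w::real. w powr (- c - 1) * min 1 (w powr (- t)))"
proof -
  have t: "0 < t" using assms by linarith
  have "set_integrable lborel {0<..1} (\<lambda>w. w powr (- c - 1) * min 1 (w powr (- t)))"
  proof (rule set_integrable_bound)
    show "set_integrable lborel {0<..1} (\<lambda>w::real. w powr (- c - 1))"
      using assms by (intro set_integrable_lborel_of_nonneg integrable_on_powr_from_0') auto
    show "set_borel_measurable lborel {0<..1} (\<lambda>w. w powr (- c - 1) * min 1 (w powr (- t)))"
      by (simp add: set_borel_measurable_def)
    show "AE w in lborel. w \<in> {0<..1} \<longrightarrow>
        norm (w powr (- c - 1) * min 1 (w powr (- t))) \<le> norm (w powr (- c - 1))"
      by (intro AE_I2) (auto simp: abs_mult intro!: mult_left_le)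
  qed
  moreover have "set_integrable lborel {1..} (\<lambda>w. w powr (- c - 1) * min 1 (w powr (- t)))"
  proof (rule set_integrable_bound)
    have "(\<lambda>w::real. w powr (- c - 1 - t)) integrable_on {1..}"
      using has_integral_powr_to_inf[of "- c - 1 - t" 1] assms by (auto simp: integrable_on_def)
    thus "set_integrable lborel {1..} (\<lambda>w::real. w powr (- c - 1 - t))"
      by (intro set_integrable_lborel_of_nonneg) auto
    show "set_borel_measurable lborel {1..} (\<lambda>w. w powr (- c - 1) * min 1 (w powr (- t)))"
      by (simp add: set_borel_measurable_def)
    show "AE w in lborel. w \<in> {1..} \<longrightarrow>
        norm (w powr (- c - 1) * min 1 (w powr (- t))) \<le> norm (w powr (- c - 1 - t))"
      by (intro AE_I2) (auto simp: abs_mult powr_diff powr_minus divide_inverse intro!: mult_left_mono)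
  qed
  ultimately have "set_integrable lborel ({0<..1} \<union> {1..}) (\<lambda>w. w powr (- c - 1) * min 1 (w powr (- t)))"
    by (rule set_integrable_Un) auto
  moreover have "{0<..1} \<union> {1..} = {0::real<..}" by auto
  ultimately show ?thesis by simp
qed

text \<open>
  The norm bound is linear in \<open>C\<close>, with a factor that depends only on \<open>a\<close>, \<open>b\<close> and \<open>t\<close>. So a family of
  functions with summable constants \<open>C\<close> has uniformly summable Mellin integrals.
\<close>
lemma mellin_power_decay:
  fixes f :: "real \<Rightarrow> complex"
  assumes cont: "continuous_on {0<..} f"
    and bound: "\<And>w. 0 < w \<Longrightarrow> norm (f w) \<le> C * min 1 (w powr (- t))"
  shows mellin_power_decay_integrable: "\<And>s. - t < Re s \<Longrightarrow> Re s < 0 \<Longrightarrow>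
          set_integrable lborel {0<..} (\<lambda>w. of_real w powr (- s - 1) * f w)"
    and mellin_power_decay_norm_le: "\<And>s a b. - t < a \<Longrightarrow> a \<le> Re s \<Longrightarrow> Re s \<le> b \<Longrightarrow> b < 0 \<Longrightarrow>
          norm (LBINT w:{0<..}. of_real w powr (- s - 1) * f w) \<le>
          C * (LBINT w:{0<..}. (w powr (- a - 1) + w powr (- b - 1)) * min 1 (w powr (- t)))"
    and mellin_power_decay_holomorphic: "(\<lambda>s. LBINT w:{0<..}. of_real w powr (- s - 1) * f w)
          holomorphic_on {s. - t < Re s \<and> Re s < 0}"
proof -
  have eq: "(\<lambda>w. (w powr (- a - 1) + w powr (- b - 1)) * (C * min 1 (w powr (- t)))) =
      (\<lambda>w. C * ((w powr (- a - 1) + w powr (- b - 1)) * min 1 (w powr (- t))))" for a b :: real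
    by (simp add: algebra_simps)
  have int: "set_integrable lborel {0<..}
      (\<lambda>w. (w powr (- a - 1) + w powr (- b - 1)) * (C * min 1 (w powr (- t))))"
    if "- t < a" "a < 0" "- t < b" "b < 0" for a b
    unfolding eq unfolding distrib_right[of "_ powr _"]
    using that by (intro set_integrable_mult_right set_integral_add(1) set_integrable_powr_min)
  show "set_integrable lborel {0<..} (\<lambda>w. of_real w powr (- s - 1) * f w)"
    if "- t < Re s" "Re s < 0" for s
    using mellin_integrable[OF cont bound int[of "Re s" "Re s"]] that by simp
  show "norm (LBINT w:{0<..}. of_real w powr (- s - 1) * f w) \<le>
      C * (LBINT w:{0<..}. (w powr (- a - 1) + w powr (- b - 1)) * min 1 (w powr (- t)))"
    if "- t < a" "a \<le> Re s" "Re s \<le> b" "b < 0" for s a b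
    using mellin_norm_le[OF cont bound int[of a b], of s] that unfolding eq by simp
  show "(\<lambda>s. LBINT w:{0<..}. of_real w powr (- s - 1) * f w)
      holomorphic_on {s. - t < Re s \<and> Re s < 0}"
    by (rule holomorphic_on_strip) (rule mellin_holomorphic[OF cont bound int], auto)
qed

section \<open>The integral of a single tuple\<close>

text \<open>
  Induction on the set of poles. A new pole \<open>- x a\<close> splits each old term by
  \<open>1 / ((z + x i) (x a - x i)) = 1 / ((z + x i) (z + x a)) - 1 / ((z + x a) (x i - x a))\<close>. The first parts add up
  to the expansion of the old product divided by \<open>z + x a\<close>; the second ones add up, by the induction
  hypothesis at \<open>z = - x a\<close>, to the negative of the term of the new pole.
\<close>

lemma partial_fractions:
  fixes x :: "'i \<Rightarrow> 'a::field"
  assumes "finite A" "A \<noteq> {}" "inj_on x A" "\<And>j. j \<in> A \<Longrightarrow> z + x j \<noteq> 0"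
  shows "1 / (\<Prod>j\<in>A. z + x j) = (\<Sum>i\<in>A. 1 / (z + x i) * (\<Prod>j\<in>A - {i}. 1 / (x j - x i)))"
  using assms
proof (induction A arbitrary: z rule: finite_ne_induct)
  case (singleton a)
  thus ?case by simp
next
  case (insert a A)
  define P where "P = (\<lambda>i. \<Prod>j\<in>A - {i}. 1 / (x j - x i))"
  have inj: "inj_on x A" using insert.prems by (simp add: inj_on_def)
  have neq: "x j - x a \<noteq> 0" if "j \<in> A" for j
    using insert.prems(1) insert.hyps that by (auto simp: inj_on_def)
  have za: "z + x a \<noteq> 0" using insert.prems by simp
  have IH: "1 / (\<Prod>j\<in>A. z + x j) = (\<Sum>i\<in>A. 1 / (z + x i) * P i)"
    unfolding P_def by (rule insert.IH[OF inj]) (use insert.prems in auto)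
  have IHa: "1 / (\<Prod>j\<in>A. x j - x a) = (\<Sum>i\<in>A. 1 / (x i - x a) * P i)"
    unfolding P_def using insert.IH[OF inj, of "- x a"] neq by auto
  have step: "1 / (z + x i) * (\<Prod>j\<in>insert a A - {i}. 1 / (x j - x i)) =
      1 / (z + x a) * (1 / (z + x i) * P i) - 1 / (z + x a) * (1 / (x i - x a) * P i)"
    if i: "i \<in> A" for i
  proof -
    have "insert a A - {i} = insert a (A - {i})" using i insert.hyps by auto
    hence "(\<Prod>j\<in>insert a A - {i}. 1 / (x j - x i)) = 1 / (x a - x i) * P i"
      using insert.hyps by (simp add: P_def)
    moreover have "1 / (z + x i) * (1 / (x a - x i)) =
        1 / (z + x a) * (1 / (z + x i)) - 1 / (z + x a) * (1 / (x i - x a))"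
    proof -
      define u v where "u = z + x i" and "v = x a - x i"
      have uv: "x i - x a = - v" "z + x a = u + v" by (simp_all add: u_def v_def)
      have "u \<noteq> 0" "v \<noteq> 0" "u + v \<noteq> 0"
        using neq[OF i] za insert.prems(2)[of i] i by (auto simp: u_def v_def)
      thus ?thesis
        unfolding uv u_def[symmetric] v_def[symmetric] by (simp add: divide_simps)
    qed
    ultimately show ?thesis
      by (simp only: left_diff_distrib mult.assoc[symmetric])
  qed
  have "(\<Sum>i\<in>insert a A. 1 / (z + x i) * (\<Prod>j\<in>insert a A - {i}. 1 / (x j - x i))) =
      1 / (z + x a) * (\<Prod>j\<in>A. 1 / (x j - x a)) +
      (\<Sum>i\<in>A. 1 / (z + x a) * (1 / (z + x i) * P i) - 1 / (z + x a) * (1 / (x i - x a) * P i))"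
    using insert.hyps step by simp
  also have "\<dots> = 1 / (z + x a) * (1 / (\<Prod>j\<in>A. z + x j))"
    unfolding sum_subtractf sum_distrib_left[symmetric] IH[symmetric] IHa[symmetric]
    by (simp add: prod_dividef)
  also have "\<dots> = 1 / (\<Prod>j\<in>insert a A. z + x j)"
    using insert.hyps by simp
  finally show ?case ..
qed

lemma Beta_reflection:
  assumes "0 < a" "a < (1::real)"
  shows "Beta a (1 - a) = pi / sin (pi * a)"
proof -
  have "complex_of_real (Gamma a * Gamma (1 - a)) = Gamma (of_real a) * Gamma (1 - of_real a)"
    using Gamma_complex_of_real[of a] Gamma_complex_of_real[of "1 - a"] by simp
  also have "\<dots> = of_real (pi / sin (pi * a))"
    using sin_of_real[of "pi * a", where 'a = complex] by (simp add: Gamma_reflection_complex)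
  finally have "complex_of_real (Gamma a * Gamma (1 - a)) = of_real (pi / sin (pi * a))" .
  hence "Gamma a * Gamma (1 - a) = pi / sin (pi * a)"
    by (simp only: of_real_eq_iff)
  thus ?thesis by (simp add: Beta_def)
qed

text \<open>
  The substitution \<open>t = w / (w + n)\<close> turns this integral into the Beta integral for \<open>(a, 1 - a)\<close>.
\<close>
lemma has_integral_powr_over_add:
  fixes a n :: real
  assumes a: "0 < a" "a < 1" and n: "0 < n"
  shows "((\<lambda>w. w powr (a - 1) / (w + n)) has_integral pi / sin (pi * a) * n powr (a - 1)) {0<..}"
proof -
  define f where "f = (\<lambda>t. t powr (a - 1) * (1 - t) powr (- a))"
  define g where "g = (\<lambda>w. w / (w + n))"
  have f: "(f has_integral (pi / sin (pi * a))) {0<..<1}"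
    using has_integral_Beta_real[of a "1 - a"] a
    by (simp add: has_integral_Icc_iff_Ioo f_def Beta_reflection)
  have absf: "f absolutely_integrable_on {0<..<1}"
    by (rule nonnegative_absolutely_integrable_1) (use f in \<open>auto simp: f_def integrable_on_def\<close>)
  have img: "g ` {0<..} = {0<..<1}"
  proof (intro equalityI subsetI)
    fix t assume "t \<in> {0<..<1::real}"
    hence "t = g (n * t / (1 - t))" "n * t / (1 - t) > 0"
      using n by (auto simp: g_def divide_simps) (simp_all add: algebra_simps)
    thus "t \<in> g ` {0<..}" by blast
  qed (use n in \<open>auto simp: g_def\<close>)
  have inj: "inj_on g {0<..}"
    using n by (auto simp: inj_on_def g_def divide_simps) (simp add: algebra_simps)
  have der: "(g has_field_derivative n / (w + n)\<^sup>2) (at w within {0<..})" if "w \<in> {0<..}" for w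
    unfolding g_def using that n
    by (auto intro!: derivative_eq_intros simp: field_simps power2_eq_square)
  have "(\<lambda>w. \<bar>n / (w + n)\<^sup>2\<bar> * f (g w)) absolutely_integrable_on {0<..} \<and>
      integral {0<..} (\<lambda>w. \<bar>n / (w + n)\<^sup>2\<bar> * f (g w)) = pi / sin (pi * a)"
    using has_absolute_integral_change_of_variables_1'[OF _ der inj, of f "pi / sin (pi * a)"]
      absf integral_unique[OF f] by (simp add: img)
  hence *: "((\<lambda>w. \<bar>n / (w + n)\<^sup>2\<bar> * f (g w)) has_integral pi / sin (pi * a)) {0<..}"
    by (simp only: has_integral_iff set_lebesgue_integral_eq_integral(1))
  have eq: "\<bar>n / (w + n)\<^sup>2\<bar> * f (g w) = n powr (1 - a) * (w powr (a - 1) / (w + n))" if "w \<in> {0<..}" for w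
  proof -
    have w: "0 < w" using that by simp
    define x where "x = w + n"
    have x: "0 < x" using w n by (simp add: x_def)
    have "1 - g w = n / x" using x by (simp add: g_def x_def field_simps)
    hence "f (g w) = (w powr (a - 1) / x powr (a - 1)) * (n powr (- a) / x powr (- a))"
      using w n x by (simp add: f_def g_def x_def powr_divide)
    also have "\<dots> = w powr (a - 1) * (n powr (1 - a) / n) * x"
      using x n by (simp add: powr_diff powr_minus divide_simps)
    finally show ?thesis
      using n x unfolding x_def[symmetric] by (simp add: power2_eq_square)
  qed
  have "((\<lambda>w. n powr (1 - a) * (w powr (a - 1) / (w + n))) has_integral pi / sin (pi * a)) {0<..}"
    using * by (rule has_integral_cong[THEN iffD1, rotated]) (rule eq)
  moreover have "n powr (a - 1) * (n powr (1 - a) * y) = y" for y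
    using n by (simp add: mult.assoc[symmetric] powr_add[symmetric])
  ultimately show ?thesis
    using has_integral_mult_right[of "\<lambda>w. n powr (1 - a) * (w powr (a - 1) / (w + n))"
        "pi / sin (pi * a)" "{0<..}" "n powr (a - 1)"]
    by (simp only: mult.commute[of "pi / sin (pi * a)"])
qed

lemma norm_inverse_add_le:
  fixes w x :: real
  assumes "0 < w" "1 \<le> x"
  shows "norm (1 / (of_real w + of_real x :: complex)) \<le> min 1 (w powr (- 1))"
proof -
  have "norm (1 / (of_real w + of_real x :: complex)) = 1 / (w + x)"
    using assms by (simp add: norm_divide flip: of_real_add)
  moreover have "1 / (w + x) \<le> 1 / 1" "1 / (w + x) \<le> 1 / w"
    using assms by (intro divide_left_mono; simp)+
  ultimately show ?thesis using assms by (simp add: powr_minus divide_inverse)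
qed

text \<open>
  On the real segment this is \<open>has_integral_powr_over_add\<close> with \<open>a = - s\<close>; the identity theorem extends it to
  the strip. Multiplying by the sine avoids a division in the statement.
\<close>
lemma mellin_inverse_add:
  fixes x :: real and s :: complex
  assumes x: "1 \<le> x" and s: "- 1 < Re s" "Re s < 0"
  shows mellin_inverse_add_integrable:
      "set_integrable lborel {0<..} (\<lambda>w. of_real w powr (- s - 1) * (1 / (of_real w + of_real x :: complex)))"
    and mellin_inverse_add_eq:
      "sin (of_real pi * s) * (LBINT w:{0<..}. of_real w powr (- s - 1) * (1 / (of_real w + of_real x :: complex))) =
         - of_real pi * of_real x powr (- s - 1)"
proof -
  define f where "f = (\<lambda>w::real. 1 / (of_real w + of_real x :: complex))"
  have cont: "continuous_on {0<..} f"
    unfolding f_def using x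
    by (intro continuous_intros) (auto simp: complex_eq_iff)
  have bound: "norm (f w) \<le> 1 * min 1 (w powr (- 1))" if "0 < w" for w
    using norm_inverse_add_le[OF that x] by (simp add: f_def)
  show "set_integrable lborel {0<..} (\<lambda>w. of_real w powr (- s - 1) * (1 / (of_real w + of_real x :: complex)))"
    using mellin_power_decay_integrable[OF cont bound s] by (simp add: f_def)
  define J where "J = (\<lambda>s. LBINT w:{0<..}. of_real w powr (- s - 1) * f w)"
  define S where "S = {s. - 1 < Re s \<and> Re s < 0}"
  have J: "J holomorphic_on S"
    using mellin_power_decay_holomorphic[OF cont bound] by (simp add: J_def S_def)
  have real_axis: "sin (of_real pi * z) * J z + of_real pi * of_real x powr (- z - 1) = 0"
    if "z \<in> of_real ` {-1<..<0}" for z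
  proof -
    from that obtain u where z: "z = of_real u" and "u \<in> {-1<..<0}" by blast
    hence u: "- 1 < u" "u < 0" by auto
    have int: "((\<lambda>w. w powr (- u - 1) / (w + x)) has_integral pi / sin (pi * (- u)) * x powr (- u - 1)) {0<..}"
      using has_integral_powr_over_add[of "- u" x] u x by simp
    have "J z = integral {0<..} (\<lambda>w. of_real w powr (- z - 1) * f w)"
      unfolding J_def
      by (rule set_borel_integral_eq_integral(2))
         (use mellin_power_decay_integrable[OF cont bound, of z] u z in simp)
    also have "\<dots> = integral {0<..} (\<lambda>w. complex_of_real (w powr (- u - 1) / (w + x)))"
    proof (rule Henstock_Kurzweil_Integration.integral_cong)
      fix w :: real assume "w \<in> {0<..}"
      thus "of_real w powr (- z - 1) * f w = complex_of_real (w powr (- u - 1) / (w + x))"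
        using powr_of_real[of w "- u - 1"] by (simp add: z f_def)
    qed
    also have "\<dots> = of_real (pi / sin (pi * (- u)) * x powr (- u - 1))"
      by (rule integral_unique[OF has_integral_of_real[OF int]])
    finally have J_eq: "J z = of_real (pi / sin (pi * (- u)) * x powr (- u - 1))" .
    have "pi * (- u) < pi * 1" using u by (intro mult_strict_left_mono) auto
    hence "sin (pi * u) \<noteq> 0"
      using sin_gt_zero[of "pi * (- u)"] u by (auto simp: mult_pos_neg)
    moreover have "complex_of_real x powr (- z - 1) = of_real (x powr (- u - 1))"
      using powr_of_real[of x "- u - 1"] x by (simp add: z)
    moreover have "sin (of_real pi * z) = complex_of_real (sin (pi * u))"
      by (simp add: z sin_of_real flip: of_real_mult)
    ultimately show ?thesis unfolding J_eq by simp
  qed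
  have "sin (of_real pi * s) * J s + of_real pi * of_real x powr (- s - 1) = 0"
  proof (rule analytic_continuation[where f = "\<lambda>z. sin (of_real pi * z) * J z + of_real pi * of_real x powr (- z - 1)"
        and S = S and U = "of_real ` {-1<..<0}" and \<xi> = "of_real (- 1 / 2)"])
    show "(\<lambda>z. sin (of_real pi * z) * J z + of_real pi * of_real x powr (- z - 1)) holomorphic_on S"
      using x by (intro holomorphic_intros J) auto
    show "open S" unfolding S_def by (rule open_strip)
    show "connected S" unfolding S_def by (rule convex_connected[OF convex_strip])
    have "(- 1 / 2 :: real) islimpt {-1<..<0}"
      by (simp add: open_imp_islimpt)
    thus "complex_of_real (- 1 / 2) islimpt of_real ` {-1<..<0}"
      by (rule islimpt_isCont_image) (auto simp: eventually_at_filter complex_eq_iff)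
  qed (use real_axis s in \<open>auto simp: S_def\<close>)
  thus "sin (of_real pi * s) * (LBINT w:{0<..}. of_real w powr (- s - 1) * (1 / (of_real w + of_real x :: complex))) =
         - of_real pi * of_real x powr (- s - 1)"
    by (simp add: J_def f_def add_eq_0_iff)
qed

lemma continuous_on_inverse_prod_add:
  "continuous_on {0<..} (\<lambda>w. 1 / (\<Prod>j<r. of_real w + of_nat (n ! j) :: complex))"
proof -
  have "of_real w + of_nat m \<noteq> (0::complex)" if "0 < w" for w :: real and m :: nat
    using that by (auto simp: complex_eq_iff)
  thus ?thesis by (intro continuous_intros) auto
qed

lemma norm_inverse_prod_add:
  assumes "0 < w"
  shows "norm (1 / (\<Prod>j<r. of_real w + of_nat (n ! j) :: complex)) = 1 / (\<Prod>j<r. w + real (n ! j))"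
proof -
  have "norm (of_real w + of_nat m :: complex) = w + real m" for m
    using assms norm_of_real[of "w + real m", where 'a = complex] by simp
  thus ?thesis by (simp add: norm_divide flip: prod_norm)
qed

lemma ohno_integrand_eq:
  assumes "length n = r"
  shows "ohno_integrand n s w =
    of_real w powr (- s - 1) * (1 / (\<Prod>j<r. of_real w + of_nat (n ! j)))"
  using assms by (simp add: ohno_integrand_def)

lemma inverse_prod_add_decay:
  assumes n: "n \<in> increasing_tuples r" and w: "0 < w"
  shows "norm (1 / (\<Prod>j<r. of_real w + of_nat (n ! j) :: complex)) \<le> 1 * min 1 (w powr (- real r))"
proof -
  have n1: "1 \<le> real (n ! j)" if "j < r" for j
    using increasing_tuples_pos[OF n that] by simp
  have "1 \<le> (\<Prod>j<r. w + real (n ! j))"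
    using n1 w by (intro prod_ge_1) (auto intro!: add_increasing)
  moreover have "w ^ r \<le> (\<Prod>j<r. w + real (n ! j))"
    using prod_mono[of "{..<r}" "\<lambda>_. w" "\<lambda>j. w + real (n ! j)"] w by auto
  ultimately have "1 / (\<Prod>j<r. w + real (n ! j)) \<le> 1 / 1" "1 / (\<Prod>j<r. w + real (n ! j)) \<le> 1 / w ^ r"
    using w by (intro divide_left_mono; auto simp: zero_less_mult_iff intro: less_le_trans[of 0 1])+
  thus ?thesis
    unfolding norm_inverse_prod_add[OF w] using w
    by (simp add: powr_minus powr_realpow divide_inverse)
qed

text \<open>
  The restriction \<open>-1 < Re s\<close> is what makes the individual partial fractions integrable; the integral on
  the left converges in the larger strip \<open>- r < Re s < 0\<close>.
\<close>
lemma ohno_integral_partial_fractions: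
  assumes n: "n \<in> increasing_tuples r" and r: "0 < r" and s: "- 1 < Re s" "Re s < 0"
  shows "- (sin (of_real pi * s) / of_real pi) * (LBINT w:{0<..}. ohno_integrand n s w) =
    (\<Sum>i<r. of_nat (n ! i) powr (- s - 1) *
       (\<Prod>j\<in>{..<r} - {i}. 1 / (of_nat (n ! j) - of_nat (n ! i))))"
proof -
  define c where "c = (\<lambda>i. \<Prod>j\<in>{..<r} - {i}. 1 / (of_nat (n ! j) - of_nat (n ! i) :: complex))"
  define h where "h = (\<lambda>i w. of_real w powr (- s - 1) * (1 / (of_real w + of_real (real (n ! i)))) :: complex)"
  have len: "length n = r" using n by (simp add: increasing_tuples_def)
  have n1: "1 \<le> real (n ! i)" if "i < r" for i using increasing_tuples_pos[OF n that] by simp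
  have inj: "inj_on (\<lambda>j. of_nat (n ! j) :: complex) {..<r}"
    using increasing_tuples_inj[OF n] by (simp add: inj_on_def)
  have eq: "ohno_integrand n s w = (\<Sum>i<r. c i * h i w)" if "0 < w" for w
  proof -
    have "1 / (\<Prod>j<r. of_real w + of_nat (n ! j)) =
        (\<Sum>i<r. 1 / (of_real w + of_nat (n ! i)) * c i)"
      unfolding c_def
      by (rule partial_fractions) (use inj r that in \<open>auto simp: complex_eq_iff\<close>)
    thus ?thesis
      by (simp only: ohno_integrand_eq[OF len] sum_distrib_left)
         (simp add: h_def mult.commute mult.left_commute)
  qed
  have int: "set_integrable lborel {0<..} (h i)" if "i < r" for i
    unfolding h_def by (rule mellin_inverse_add_integrable[OF n1[OF that] s])
  have "(LBINT w:{0<..}. ohno_integrand n s w) = (LBINT w:{0<..}. (\<Sum>i<r. c i * h i w))"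
    by (rule set_lebesgue_integral_cong) (use eq in auto)
  also have "\<dots> = (\<Sum>i<r. c i * (LBINT w:{0<..}. h i w))"
    unfolding set_integral_mult_right[symmetric] unfolding set_lebesgue_integral_def scaleR_sum_right
    by (rule Bochner_Integration.integral_sum)
       (use set_integrable_mult_right[OF int] in \<open>auto simp: set_integrable_def\<close>)
  finally have "- (sin (of_real pi * s) / of_real pi) * (LBINT w:{0<..}. ohno_integrand n s w) =
      (\<Sum>i<r. c i * (- (sin (of_real pi * s) * (LBINT w:{0<..}. h i w)) / of_real pi))"
    by (simp only: sum_distrib_left) (rule sum.cong, simp_all)
  also have "\<dots> = (\<Sum>i<r. c i * of_nat (n ! i) powr (- s - 1))"
  proof (rule sum.cong[OF refl])
    fix i assume "i \<in> {..<r}"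
    hence "sin (of_real pi * s) * (LBINT w:{0<..}. h i w) = - of_real pi * of_nat (n ! i) powr (- s - 1)"
      unfolding h_def using mellin_inverse_add_eq[OF n1 s, of i] by simp
    thus "c i * (- (sin (of_real pi * s) * (LBINT w:{0<..}. h i w)) / of_real pi) =
        c i * of_nat (n ! i) powr (- s - 1)" by simp
  qed
  finally show ?thesis by (simp add: c_def mult.commute)
qed

section \<open>The Ohno series\<close>

text \<open>
  The summand of the defining series, with one factor of each \<open>n\<^sub>j\<close> cancelled between the denominator
  and the product. This is the shape in which partial fractions produce it.
\<close>

definition ohno_summand :: "nat list \<Rightarrow> nat \<Rightarrow> nat list \<Rightarrow> complex \<Rightarrow> complex" where
  "ohno_summand k i n s =
     1 / (\<Prod>j<length k. of_nat (n ! j) ^ (k ! j - 1)) *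
     (of_nat (n ! i) powr (- s - 1) *
      (\<Prod>j\<in>{..<length k} - {i}. 1 / (of_nat (n ! j) - of_nat (n ! i))))"

lemma ohno_series_eq:
  assumes k: "\<And>j. j < length k \<Longrightarrow> 1 \<le> k ! j"
  shows "ohno_series k s =
    (\<Sum>i<length k. \<Sum>\<^sub>\<infinity>n\<in>increasing_tuples (length k). ohno_summand k i n s)"
  unfolding ohno_series_def
proof (intro sum.cong infsum_cong refl)
  fix i n assume i: "i \<in> {..<length k}" and n: "n \<in> increasing_tuples (length k)"
  define P where "P = (\<Prod>j<length k. of_nat (n ! j) ^ (k ! j - 1) :: complex)"
  define N where "N = (\<Prod>j\<in>{..<length k} - {i}. of_nat (n ! j) :: complex)"
  define D where "D = (\<Prod>j\<in>{..<length k} - {i}. of_nat (n ! j) - of_nat (n ! i) :: complex)"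
  have nz: "of_nat (n ! j) \<noteq> (0::complex)" if "j < length k" for j
    using increasing_tuples_pos[OF n that] by simp
  have N: "N \<noteq> 0" unfolding N_def using nz by simp
  have "(\<Prod>j<length k. of_nat (n ! j) ^ (k ! j) :: complex) =
      (\<Prod>j<length k. of_nat (n ! j) ^ (k ! j - 1) * of_nat (n ! j))"
    by (intro prod.cong refl) (use k in \<open>force simp: power_eq_if\<close>)
  also have "\<dots> = P * (of_nat (n ! i) * N)"
    unfolding prod.distrib P_def N_def using i by (simp add: prod.remove)
  finally have "(\<Prod>j<length k. of_nat (n ! j) ^ (k ! j)) = P * (of_nat (n ! i) * N)" .
  moreover have "of_nat (n ! i) powr (- s - 1) = 1 / (of_nat (n ! i) powr s * of_nat (n ! i) :: complex)"
    using nz i by (simp add: powr_diff powr_minus divide_inverse)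
  ultimately show "1 / (\<Prod>j<length k. of_nat (n ! j) ^ (k ! j)) * (1 / of_nat (n ! i) powr s) *
      (\<Prod>j\<in>{..<length k} - {i}. of_nat (n ! j) / (of_nat (n ! j) - of_nat (n ! i))) =
      ohno_summand k i n s"
    using N unfolding ohno_summand_def prod_dividef P_def[symmetric] N_def[symmetric] D_def[symmetric]
    by simp
qed

text \<open>
  The entry \<open>n\<^sub>i\<close> together with the distances of all other entries to it. For a fixed position \<open>i\<close> the sign of
  \<open>n\<^sub>j - n\<^sub>i\<close> is known, so an increasing tuple can be recovered from these numbers, and a sum over increasing
  tuples is at most a sum over independent positive integers.
\<close>
definition gaps :: "nat \<Rightarrow> nat list \<Rightarrow> nat list" where
  "gaps i n = map (\<lambda>j. if j < i then n ! i - n ! j else if j = i then n ! i else n ! j - n ! i)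
                [0..<length n]"

lemma length_gaps [simp]: "length (gaps i n) = length n"
  by (simp add: gaps_def)

lemma gaps_nth:
  assumes "n \<in> increasing_tuples r" "j < r"
  shows "gaps i n ! j = (if j < i then n ! i - n ! j else if j = i then n ! i else n ! j - n ! i)"
  using assms by (simp add: gaps_def increasing_tuples_def)

lemma gaps_pos:
  assumes n: "n \<in> increasing_tuples r" and "i < r" "j < r"
  shows "0 < gaps i n ! j"
  using increasing_tuples_less[OF n, of i j] increasing_tuples_less[OF n, of j i]
    increasing_tuples_pos[OF n, of i] assms by (simp add: gaps_nth)

lemma inj_on_gaps:
  assumes i: "i < r"
  shows "inj_on (gaps i) (increasing_tuples r)"
proof (rule inj_onI)
  fix n m assume nm: "n \<in> increasing_tuples r" "m \<in> increasing_tuples r" "gaps i n = gaps i m"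
  have eq: "gaps i n ! j = gaps i m ! j" for j using nm(3) by simp
  have ni: "n ! i = m ! i"
    using eq[of i] i nm(1,2) by (simp add: gaps_nth)
  have "n ! j = m ! j" if j: "j < r" for j
  proof (cases j i rule: linorder_cases)
    case less
    thus ?thesis
      using eq[of j] j ni i nm(1,2) increasing_tuples_less[OF nm(1) less i]
        increasing_tuples_less[OF nm(2) less i] by (simp add: gaps_nth)
  next
    case greater
    thus ?thesis
      using eq[of j] j ni nm(1,2) increasing_tuples_less[OF nm(1) greater j]
        increasing_tuples_less[OF nm(2) greater j] by (simp add: gaps_nth)
  qed (use ni in simp)
  thus "n = m" using nm(1,2) by (intro nth_equalityI) (auto simp: increasing_tuples_def)
qed

lemma summable_on_gaps:
  assumes "1 < a" "i < r"
  shows "(\<lambda>n. \<Prod>j<r. real (gaps i n ! j) powr (- a)) summable_on increasing_tuples r"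
proof -
  have sub: "gaps i ` increasing_tuples r \<subseteq> {n. length n = r \<and> set n \<subseteq> {0<..}}"
  proof clarsimp
    fix n assume n: "n \<in> increasing_tuples r"
    hence "length n = r" by (simp add: increasing_tuples_def)
    thus "length n = r \<and> set (gaps i n) \<subseteq> {0<..}"
      using gaps_pos[OF n assms(2)] by (auto simp: in_set_conv_nth)
  qed
  have "(\<lambda>n. \<Prod>j<r. real (n ! j) powr (- a)) summable_on gaps i ` increasing_tuples r"
    using summable_on_prod_powr[OF assms(1)] sub by (rule summable_on_subset_banach)
  thus ?thesis
    by (simp add: summable_on_reindex[OF inj_on_gaps[OF assms(2)]] o_def)
qed

lemma abs_diff_eq_gaps:
  assumes n: "n \<in> increasing_tuples r" and ij: "i < r" "j < r" "j \<noteq> i"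
  shows "\<bar>real (n ! j) - real (n ! i)\<bar> = real (gaps i n ! j)"
  using increasing_tuples_less[OF n, of i j] increasing_tuples_less[OF n, of j i] ij
  by (simp add: gaps_nth[OF n] of_nat_diff neq_iff) (auto simp: of_nat_diff)

lemma prod_power_ge_last:
  assumes k: "admissible k" and n: "n \<in> increasing_tuples (length k)"
  shows "real (n ! (length k - 1)) \<le> (\<Prod>j<length k. real (n ! j) ^ (k ! j - 1))"
proof -
  define l where "l = length k - 1"
  have l: "l < length k" "2 \<le> k ! l"
    using k by (auto simp: admissible_def l_def last_conv_nth)
  have n1: "1 \<le> real (n ! j)" if "j < length k" for j
    using increasing_tuples_pos[OF n that] by simp
  have "real (n ! l) * 1 \<le> real (n ! l) ^ (k ! l - 1) * (\<Prod>j\<in>{..<length k} - {l}. real (n ! j) ^ (k ! j - 1))"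
    using n1 l self_le_power[of "real (n ! l)" "k ! l - 1"]
    by (intro mult_mono prod_ge_1) (auto intro: one_le_power)
  also have "\<dots> = (\<Prod>j<length k. real (n ! j) ^ (k ! j - 1))"
    using l by (subst (2) prod.remove[of _ l]) auto
  finally show ?thesis by (simp add: l_def)
qed

text \<open>
  Write \<open>N\<close> for the last entry. Since the last exponent is at least \<open>2\<close>, the summand contains a factor \<open>1 / N\<close>.
  It is split as \<open>N powr (- (1 - \<eta> / 2)) * N powr (- (\<eta> / 2))\<close>. As \<open>N\<close> is at least \<open>n\<^sub>i\<close>, the first part improves
  \<open>n\<^sub>i powr (- \<eta>)\<close> to \<open>n\<^sub>i powr (- (1 + \<eta> / 2))\<close>. As \<open>N\<close> is at least every difference, the second part supplies
  the small power \<open>- e\<close> that each \<open>1 / \<bar>n\<^sub>j - n\<^sub>i\<bar>\<close> lacks for convergence.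
\<close>
lemma ohno_summand_bound:
  assumes k: "admissible k" and i: "i < length k" and n: "n \<in> increasing_tuples (length k)"
    and eta: "0 < \<eta>" "\<eta> \<le> 1" "\<eta> - 1 \<le> Re s"
  defines "e \<equiv> \<eta> / (2 * real (length k))"
  shows "norm (ohno_summand k i n s) \<le> (\<Prod>j<length k. real (gaps i n ! j) powr (- (1 + e)))"
proof -
  define r where "r = length k"
  define N where "N = real (n ! (r - 1))"
  define x where "x = real (n ! i)"
  define d where "d = (\<lambda>j. real (gaps i n ! j))"
  define J where "J = {..<r} - {i}"
  have n': "n \<in> increasing_tuples r" and i': "i < r" using n i by (simp_all add: r_def)
  have r: "0 < r" using i' by simp
  have e: "0 < e" "e \<le> \<eta> / 2" "e * real (card J) \<le> \<eta> / 2"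
  proof -
    show "0 < e" using eta r by (simp add: e_def r_def)
    have "\<eta> / 2 * 1 \<le> \<eta> / 2 * real r" using r eta by (intro mult_left_mono) auto
    thus "e \<le> \<eta> / 2" using r by (simp add: e_def field_simps flip: r_def)
    have "\<eta> / 2 * real (card J) \<le> \<eta> / 2 * real r"
      using eta i' by (intro mult_left_mono) (auto simp: J_def)
    thus "e * real (card J) \<le> \<eta> / 2" using r by (simp add: e_def field_simps flip: r_def)
  qed
  have x1: "1 \<le> x" using increasing_tuples_pos[OF n' i'] by (simp add: x_def)
  have xN: "x \<le> N" using increasing_tuples_mono[OF n', of i "r - 1"] i' by (simp add: x_def N_def)
  have N1: "1 \<le> N" using x1 xN by simp
  have d: "1 \<le> d j" "d j \<le> N" if "j < r" for j
  proof -
    show "1 \<le> d j" using gaps_pos[OF n' i' that] by (simp add: d_def)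
    have "n ! j \<le> n ! (r - 1)" "n ! i \<le> n ! (r - 1)"
      using increasing_tuples_mono[OF n', of _ "r - 1"] that i' by auto
    thus "d j \<le> N" unfolding d_def N_def gaps_nth[OF n' that]
      by (auto intro: le_trans[OF diff_le_self])
  qed
  have "norm (ohno_summand k i n s) = 1 / (\<Prod>j<r. real (n ! j) ^ (k ! j - 1)) *
      (x powr (- Re s - 1) * (\<Prod>j\<in>J. 1 / d j))"
  proof -
    have "norm (of_nat (n ! i) powr (- s - 1) :: complex) = x powr (- Re s - 1)"
      using norm_powr_real_powr[of "of_nat (n ! i)" "- s - 1"] by (simp add: x_def)
    moreover have "norm (\<Prod>j\<in>J. 1 / (of_nat (n ! j) - of_nat (n ! i) :: complex)) = (\<Prod>j\<in>J. 1 / d j)"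
      unfolding prod_norm[symmetric]
    proof (rule prod.cong[OF refl])
      fix j assume j: "j \<in> J"
      have "norm (of_nat (n ! j) - of_nat (n ! i) :: complex) = \<bar>real (n ! j) - real (n ! i)\<bar>"
        using norm_of_real[of "real (n ! j) - real (n ! i)", where 'a = complex] by simp
      thus "norm (1 / (of_nat (n ! j) - of_nat (n ! i) :: complex)) = 1 / d j"
        using abs_diff_eq_gaps[OF n' i', of j] j by (simp add: norm_divide d_def J_def)
    qed
    ultimately show ?thesis
      by (simp add: ohno_summand_def norm_mult norm_divide norm_power r_def J_def flip: prod_norm)
  qed
  also have "\<dots> \<le> (x powr (- (1 - \<eta> / 2)) * (\<Prod>j\<in>J. d j powr (- e))) *
      (x powr (- \<eta>) * (\<Prod>j\<in>J. 1 / d j))"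
  proof (intro mult_mono)
    have "1 / (\<Prod>j<r. real (n ! j) ^ (k ! j - 1)) \<le> 1 / N"
      using prod_power_ge_last[OF k n] N1 unfolding N_def r_def
      by (intro divide_left_mono) auto
    also have "\<dots> = N powr (- (1 - \<eta> / 2)) * N powr (- (\<eta> / 2))"
      using N1 by (simp only: powr_add[symmetric]) (simp add: powr_minus_divide)
    also have "\<dots> \<le> x powr (- (1 - \<eta> / 2)) * (\<Prod>j\<in>J. d j powr (- e))"
    proof (intro mult_mono)
      show "N powr (- (1 - \<eta> / 2)) \<le> x powr (- (1 - \<eta> / 2))"
        using x1 xN eta by (intro powr_mono2') auto
      have "N powr (- (\<eta> / 2)) \<le> N powr (- (e * real (card J)))"
        using e N1 by (intro powr_mono) auto
      also have "\<dots> = (\<Prod>j\<in>J. N powr (- e))"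
        using N1 by (simp add: powr_powr powr_realpow[symmetric])
      also have "\<dots> \<le> (\<Prod>j\<in>J. d j powr (- e))"
      proof (rule prod_mono)
        fix j assume "j \<in> J"
        thus "0 \<le> N powr (- e) \<and> N powr (- e) \<le> d j powr (- e)"
          using d[of j] e by (auto simp: J_def intro!: powr_mono2')
      qed
      finally show "N powr (- (\<eta> / 2)) \<le> (\<Prod>j\<in>J. d j powr (- e))" .
    qed auto
    finally show "1 / (\<Prod>j<r. real (n ! j) ^ (k ! j - 1)) \<le>
        x powr (- (1 - \<eta> / 2)) * (\<Prod>j\<in>J. d j powr (- e))" .
    show "x powr (- Re s - 1) \<le> x powr (- \<eta>)" using x1 eta by (intro powr_mono) auto
  qed (auto intro!: mult_nonneg_nonneg prod_nonneg simp: d_def)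
  also have "\<dots> = x powr (- (1 + \<eta> / 2)) * (\<Prod>j\<in>J. d j powr (- (1 + e)))"
  proof -
    have x_part: "x powr (- (1 - \<eta> / 2)) * x powr (- \<eta>) = x powr (- (1 + \<eta> / 2))"
      unfolding powr_add[symmetric] by (rule arg_cong[where f = "\<lambda>y. x powr y"]) simp
    have gap_part: "(\<Prod>j\<in>J. d j powr (- e)) * (\<Prod>j\<in>J. 1 / d j) = (\<Prod>j\<in>J. d j powr (- (1 + e)))"
      unfolding prod.distrib[symmetric]
    proof (rule prod.cong[OF refl])
      fix j assume "j \<in> J"
      hence "0 < d j" using d(1)[of j] by (auto simp: J_def)
      thus "d j powr (- e) * (1 / d j) = d j powr (- (1 + e))"
        by (simp add: powr_diff powr_minus divide_inverse mult.commute)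
    qed
    have regroup: "a * b * (c * d) = (a * c) * (b * d)" for a b c d :: real by simp
    show ?thesis by (subst regroup) (simp only: x_part gap_part)
  qed
  also have "\<dots> \<le> x powr (- (1 + e)) * (\<Prod>j\<in>J. d j powr (- (1 + e)))"
    using x1 e by (intro mult_right_mono powr_mono prod_nonneg) auto
  also have "\<dots> = d i powr (- (1 + e)) * (\<Prod>j\<in>J. d j powr (- (1 + e)))"
    using gaps_nth[OF n' i', of i] by (simp add: d_def x_def)
  also have "\<dots> = (\<Prod>j<r. d j powr (- (1 + e)))"
    unfolding J_def using i' by (intro prod.remove[symmetric]) auto
  finally show ?thesis by (simp add: d_def r_def)
qed

lemma ohno_summand_majorant:
  assumes "admissible k" "i < length k" "0 < \<eta>" "\<eta> \<le> 1"
  obtains B where "B summable_on increasing_tuples (length k)"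
    "\<And>n s. n \<in> increasing_tuples (length k) \<Longrightarrow> \<eta> - 1 \<le> Re s \<Longrightarrow> norm (ohno_summand k i n s) \<le> B n"
proof
  define e where "e = \<eta> / (2 * real (length k))"
  have "0 < real (length k)" using assms(2) by (cases k) auto
  hence "1 < 1 + e" using assms(3) by (simp add: e_def)
  thus "(\<lambda>n. \<Prod>j<length k. real (gaps i n ! j) powr (- (1 + e))) summable_on increasing_tuples (length k)"
    using assms(2) by (rule summable_on_gaps)
  show "norm (ohno_summand k i n s) \<le> (\<Prod>j<length k. real (gaps i n ! j) powr (- (1 + e)))"
    if "n \<in> increasing_tuples (length k)" "\<eta> - 1 \<le> Re s" for n s
    unfolding e_def using ohno_summand_bound[OF assms(1,2) that(1) assms(3,4) that(2)] .
qed

lemma ohno_summand_summable: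
  assumes "admissible k" "i < length k" "- 1 < Re s"
  shows "(\<lambda>n. ohno_summand k i n s) summable_on increasing_tuples (length k)"
proof -
  define \<eta> where "\<eta> = min 1 (Re s + 1)"
  have eta: "0 < \<eta>" "\<eta> \<le> 1" "\<eta> - 1 \<le> Re s" using assms(3) by (auto simp: \<eta>_def)
  obtain B where B: "B summable_on increasing_tuples (length k)"
    "\<And>n s. n \<in> increasing_tuples (length k) \<Longrightarrow> \<eta> - 1 \<le> Re s \<Longrightarrow> norm (ohno_summand k i n s) \<le> B n"
    using ohno_summand_majorant[OF assms(1,2) eta(1,2)] by blast
  show ?thesis
    by (rule abs_summable_summable, rule summable_on_comparison_test[OF B(1)])
       (use B(2) eta in auto)
qed

lemma ohno_series_holomorphic:
  assumes k: "admissible k"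
  shows "ohno_series k holomorphic_on {s. - 1 < Re s}"
proof (rule analytic_imp_holomorphic, subst analytic_on_analytic_at, intro ballI)
  fix s :: complex assume "s \<in> {s. - 1 < Re s}"
  hence s: "- 1 < Re s" by simp
  \<comment> \<open>half the distance to the boundary line, so that \<open>s\<close> is an interior point of the half-plane \<open>\<eta> - 1 < Re\<close>\<close>
  define \<eta> where "\<eta> = min 1 ((Re s + 1) / 2)"
  have eta: "0 < \<eta>" "\<eta> \<le> 1" "\<eta> - 1 < Re s" using s by (auto simp: \<eta>_def min_def)
  define S where "S = {s. \<eta> - 1 < Re s}"
  have S: "open S" "s \<in> S" using eta by (auto simp: S_def open_halfspace_Re_gt)
  have "(\<lambda>s. \<Sum>\<^sub>\<infinity>n\<in>increasing_tuples (length k). ohno_summand k i n s) holomorphic_on S"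
    if i: "i < length k" for i
  proof -
    obtain B where B: "B summable_on increasing_tuples (length k)"
      "\<And>n s. n \<in> increasing_tuples (length k) \<Longrightarrow> \<eta> - 1 \<le> Re s \<Longrightarrow> norm (ohno_summand k i n s) \<le> B n"
      using ohno_summand_majorant[OF k i eta(1,2)] by blast
    show ?thesis
    proof (rule holomorphic_on_infsum[OF S(1) _ _ B(1)])
      fix n assume n: "n \<in> increasing_tuples (length k)"
      show "(\<lambda>s. ohno_summand k i n s) holomorphic_on S"
        unfolding ohno_summand_def
        by (intro holomorphic_intros) (use increasing_tuples_pos[OF n i] in auto)
    qed (use B(2) in \<open>auto simp: S_def\<close>)
  qed
  hence "(\<lambda>s. \<Sum>i<length k. \<Sum>\<^sub>\<infinity>n\<in>increasing_tuples (length k). ohno_summand k i n s) holomorphic_on S"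
    by (intro holomorphic_on_sum) auto
  moreover have "ohno_series k = (\<lambda>s. \<Sum>i<length k. \<Sum>\<^sub>\<infinity>n\<in>increasing_tuples (length k). ohno_summand k i n s)"
    by (rule ext, rule ohno_series_eq) (use k in \<open>auto simp: admissible_def\<close>)
  ultimately show "ohno_series k analytic_on {s}"
    using S by (auto simp: analytic_at)
qed

section \<open>Convergence of the series of integrals\<close>

text \<open>
  Summation by parts in multiplicative form: since the \<open>x j\<close> increase, moving positive exponent from a later factor
  to an earlier one can only decrease the product, and the suffix condition allows to move all of it to
  the first factor.
\<close>

lemma prod_powr_ge_of_suffix_sums:
  fixes x d :: "nat \<Rightarrow> real"
  assumes "0 < c" "\<And>j. j < r \<Longrightarrow> c \<le> x j" "\<And>i j. i \<le> j \<Longrightarrow> j < r \<Longrightarrow> x i \<le> x j"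
    and "\<And>p. p < r \<Longrightarrow> 0 \<le> (\<Sum>j\<in>{p..<r}. d j)"
  shows "c powr (\<Sum>j<r. d j) \<le> (\<Prod>j<r. x j powr d j)"
  using assms
proof (induction r arbitrary: c x d)
  case 0
  thus ?case by simp
next
  case (Suc r)
  have x0: "0 < x 0" "c \<le> x 0" using Suc.prems(1) Suc.prems(2)[of 0] by auto
  have "x 0 powr (\<Sum>j<r. d (Suc j)) \<le> (\<Prod>j<r. x (Suc j) powr d (Suc j))"
  proof (rule Suc.IH[OF x0(1)])
    show "0 \<le> (\<Sum>j\<in>{p..<r}. d (Suc j))" if "p < r" for p
      using Suc.prems(4)[of "Suc p"] that
      by (simp add: sum.shift_bounds_Suc_ivl del: sum.op_ivl_Suc)
  qed (use Suc.prems(3) in auto)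
  hence "x 0 powr d 0 * x 0 powr (\<Sum>j<r. d (Suc j)) \<le> (\<Prod>j<Suc r. x j powr d j)"
    unfolding prod.lessThan_Suc_shift by (intro mult_left_mono) auto
  moreover have "x 0 powr d 0 * x 0 powr (\<Sum>j<r. d (Suc j)) = x 0 powr (\<Sum>j<Suc r. d j)"
    unfolding sum.lessThan_Suc_shift by (simp add: powr_add)
  moreover have "c powr (\<Sum>j<Suc r. d j) \<le> x 0 powr (\<Sum>j<Suc r. d j)"
    using Suc.prems(1) Suc.prems(4)[of 0] x0 by (intro powr_mono2) (auto simp: lessThan_atLeast0)
  ultimately show ?case by linarith
qed

lemma powr_interpolation:
  fixes w n :: real
  assumes "0 < w" "0 < n" "0 \<le> t" "t \<le> 1"
  shows "w powr t * n powr (1 - t) \<le> w + n"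
proof -
  have "w powr t * n powr (1 - t) \<le> (w + n) powr t * (w + n) powr (1 - t)"
    using assms by (intro mult_mono powr_mono2) auto
  also have "\<dots> = w + n" using assms by (simp flip: powr_add)
  finally show ?thesis .
qed

text \<open>
  The weights of the interpolation are \<open>\<theta>\<^sub>p = T p - T (Suc p)\<close> with \<open>T p = max (t - p) 0\<close>. They spend the total
  \<open>t\<close> greedily from the front, so that \<open>T p\<close>, the part of \<open>t\<close> charged to the factors from position \<open>p\<close> on, is as
  small as the constraint \<open>\<theta>\<^sub>j \<le> 1\<close> permits. The suffix hypothesis says that the exponents left over after
  taking out \<open>1 + e\<close> from each have nonnegative suffix sums, so that part of the product is at least \<open>1\<close>.
\<close>
lemma exponent_shift_bound:
  assumes n: "n \<in> increasing_tuples r" and w: "0 < w"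
    and k: "\<And>j. j < r \<Longrightarrow> 1 \<le> k ! j" and t: "0 \<le> t" "t \<le> real r"
    and suffix: "\<And>p. p < r \<Longrightarrow> max (t - real p) 0 + real (r - p) * e \<le> (\<Sum>j\<in>{p..<r}. real (k ! j) - 1)"
  shows "1 / (\<Prod>j<r. real (n ! j) ^ (k ! j - 1)) * (1 / (\<Prod>j<r. w + real (n ! j))) \<le>
           w powr (- t) * (\<Prod>j<r. real (n ! j) powr (- (1 + e)))"
proof -
  define T where "T = (\<lambda>p. max (t - real p) 0)"
  define th where "th = (\<lambda>j. T j - T (Suc j))"
  have th: "0 \<le> th j" "th j \<le> 1" for j by (auto simp: th_def T_def)
  have sum_th: "(\<Sum>j\<in>{p..<r}. th j) = T p" if "p \<le> r" for p
  proof -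
    have "(\<Sum>j\<in>{p..<r}. th j) = T p - T r"
      using sum_Suc_diff'[OF that, of "\<lambda>j. - T j"] by (simp add: th_def)
    thus ?thesis using t by (simp add: T_def)
  qed
  have np: "0 < real (n ! j)" if "j < r" for j using increasing_tuples_pos[OF n that] by simp
  define d where "d = (\<lambda>j. real (k ! j) - 1 - th j - e)"
  have ge1: "1 \<le> (\<Prod>j<r. real (n ! j) powr d j)"
  proof -
    have "1 powr (\<Sum>j<r. d j) \<le> (\<Prod>j<r. real (n ! j) powr d j)"
    proof (rule prod_powr_ge_of_suffix_sums)
      show "1 \<le> real (n ! j)" if "j < r" for j
        using increasing_tuples_pos[OF n that] by simp
      show "real (n ! i) \<le> real (n ! j)" if "i \<le> j" "j < r" for i j
        using increasing_tuples_mono[OF n that] by simp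
      show "0 \<le> (\<Sum>j\<in>{p..<r}. d j)" if p: "p < r" for p
        using suffix[OF p] sum_th[of p] p unfolding d_def by (simp add: sum_subtractf T_def)
    qed auto
    thus ?thesis by simp
  qed
  define Q where "Q = (\<Prod>j<r. real (n ! j) powr (1 + e))"
  have Q: "0 < Q" using np unfolding Q_def by (intro prod_pos) auto
  have "w powr t * Q \<le> w powr t * ((\<Prod>j<r. real (n ! j) powr d j) * Q)"
    using ge1 Q by (intro mult_left_mono) auto
  also have "\<dots> = (\<Prod>j<r. w powr th j) * ((\<Prod>j<r. real (n ! j) powr d j) * Q)"
    using sum_th[of 0] w t by (simp add: T_def lessThan_atLeast0 flip: powr_sum)
  also have "\<dots> = (\<Prod>j<r. real (n ! j) ^ (k ! j - 1) * (w powr th j * real (n ! j) powr (1 - th j)))"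
    unfolding Q_def prod.distrib[symmetric]
  proof (rule prod.cong[OF refl])
    fix j assume j: "j \<in> {..<r}"
    have "d j + (1 + e) = real (k ! j - 1) + (1 - th j)"
      using k[of j] j by (simp add: d_def of_nat_diff)
    hence "real (n ! j) powr d j * real (n ! j) powr (1 + e) =
        real (n ! j) ^ (k ! j - 1) * real (n ! j) powr (1 - th j)"
      using np[of j] j by (simp only: powr_add[symmetric] powr_realpow[symmetric] lessThan_iff)
    thus "w powr th j * (real (n ! j) powr d j * real (n ! j) powr (1 + e)) =
        real (n ! j) ^ (k ! j - 1) * (w powr th j * real (n ! j) powr (1 - th j))" by simp
  qed
  also have "\<dots> \<le> (\<Prod>j<r. real (n ! j) ^ (k ! j - 1) * (w + real (n ! j)))"
    using powr_interpolation[OF w np th] by (intro prod_mono) (auto intro!: mult_left_mono)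
  also have "\<dots> = (\<Prod>j<r. real (n ! j) ^ (k ! j - 1)) * (\<Prod>j<r. w + real (n ! j))"
    by (simp add: prod.distrib)
  finally have main: "w powr t * Q \<le> \<dots>" .
  have "1 / ((\<Prod>j<r. real (n ! j) ^ (k ! j - 1)) * (\<Prod>j<r. w + real (n ! j))) \<le> 1 / (w powr t * Q)"
    using main w Q by (intro divide_left_mono mult_pos_pos prod_pos) (use np in \<open>auto intro: add_pos_pos\<close>)
  also have "\<dots> = w powr (- t) * (\<Prod>j<r. real (n ! j) powr (- (1 + e)))"
    unfolding Q_def powr_minus by (simp add: divide_inverse prod_inversef[symmetric] o_def)
  finally show ?thesis by simp
qed

text \<open>
  The left end of the strip of convergence. Counting positions from \<open>0\<close>, its \<open>p\<close>-th candidate is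
  \<open>- (p + \<Sum>j\<in>{p..<r}. (k ! j - 1))\<close>, see \<open>abscissa_exponent_eq\<close>; the bound \<open>- r\<close> continues this pattern to
  \<open>p = r\<close>.
\<close>
definition abscissa :: "nat list \<Rightarrow> real" where
  "abscissa k = max (- real (length k))
     (MAX j\<in>{1..length k}.
        real (length k) - 2 * real j + 2 - (\<Sum>i=j..length k. real (k ! (i - 1))))"

lemma suffix_sum_ge_1:
  assumes k: "admissible k" and p: "p < length k"
  shows "1 \<le> (\<Sum>j\<in>{p..<length k}. real (k ! j) - 1)"
proof -
  define l where "l = length k - 1"
  have l: "l \<in> {p..<length k}" "2 \<le> k ! l"
    using k p by (auto simp: admissible_def l_def last_conv_nth)
  have "1 \<le> real (k ! l) - 1" using l by simp
  also have "\<dots> \<le> (\<Sum>j\<in>{p..<length k}. real (k ! j) - 1)"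
    by (rule member_le_sum) (use l k in \<open>auto simp: admissible_def\<close>)
  finally show ?thesis .
qed

lemma abscissa_exponent_eq:
  assumes "p < r"
  shows "real r - 2 * real (Suc p) + 2 - (\<Sum>i=Suc p..r. real (k ! (i - 1))) =
    - (real p + (\<Sum>j\<in>{p..<r}. real (k ! j) - 1))"
proof -
  have "(\<Sum>i=Suc p..r. real (k ! (i - 1))) = (\<Sum>j\<in>{p..<r}. real (k ! j))"
    using sum.shift_bounds_Suc_ivl[of "\<lambda>i. real (k ! (i - 1))" p r]
    by (simp add: atLeastLessThanSuc_atLeastAtMost del: sum.op_ivl_Suc)
  thus ?thesis using assms by (simp add: sum_subtractf)
qed

lemma abscissa_ge:
  assumes "p < length k"
  shows "- (real p + (\<Sum>j\<in>{p..<length k}. real (k ! j) - 1)) \<le> abscissa k"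
  unfolding abscissa_exponent_eq[OF assms, symmetric] abscissa_def
  using assms by (intro max.coboundedI2 Max_ge imageI) (auto intro!: image_eqI[of _ _ "Suc p"])

lemma abscissa_ge_minus_length: "- real (length k) \<le> abscissa k"
  by (simp add: abscissa_def)

lemma abscissa_le:
  assumes k: "admissible k"
  shows "abscissa k \<le> - 1"
proof -
  have k0: "k \<noteq> []" using k by (simp add: admissible_def)
  have "(MAX j\<in>{1..length k}.
      real (length k) - 2 * real j + 2 - (\<Sum>i=j..length k. real (k ! (i - 1)))) \<le> - 1"
  proof (rule Max.boundedI)
    fix y assume "y \<in> (\<lambda>j. real (length k) - 2 * real j + 2 - (\<Sum>i=j..length k. real (k ! (i - 1)))) `
        {1..length k}"
    then obtain j where j: "j \<in> {1..length k}"
      "y = real (length k) - 2 * real j + 2 - (\<Sum>i=j..length k. real (k ! (i - 1)))" by blast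
    then obtain p where p: "j = Suc p" "p < length k" by (cases j) auto
    have "y = - (real p + (\<Sum>j\<in>{p..<length k}. real (k ! j) - 1))"
      unfolding j(2) p(1) by (rule abscissa_exponent_eq[OF p(2)])
    thus "y \<le> - 1" using suffix_sum_ge_1[OF k p(2)] by simp
  qed (use k0 in \<open>auto simp: Suc_le_eq\<close>)
  moreover have "- real (length k) \<le> - 1" using k0 by (cases k) auto
  ultimately show ?thesis by (simp add: abscissa_def)
qed

text \<open>
  For \<open>t < - abscissa k\<close> all the suffix conditions of \<open>exponent_shift_bound\<close> hold strictly with \<open>e = 0\<close>; there are
  finitely many of them, so a common \<open>e > 0\<close> fits into the gaps.
\<close>
lemma ex_slack:
  assumes k: "admissible k" and t: "t < - abscissa k"
  obtains e where "0 < e"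
    "\<And>p. p < length k \<Longrightarrow>
       max (t - real p) 0 + real (length k - p) * e \<le> (\<Sum>j\<in>{p..<length k}. real (k ! j) - 1)"
proof
  define r where "r = length k"
  define c where "c = (\<lambda>p. (\<Sum>j\<in>{p..<length k}. real (k ! j) - 1))"
  define D where "D = (\<lambda>p. c p - max (t - real p) 0) ` {..<r}"
  have r: "0 < r" using k by (auto simp: r_def admissible_def)
  have D: "finite D" "D \<noteq> {}" using r by (auto simp: D_def)
  have "0 < y" if "y \<in> D" for y
  proof -
    from that obtain p where p: "p < r" "y = c p - max (t - real p) 0" by (auto simp: D_def)
    thus ?thesis
      using suffix_sum_ge_1[OF k, of p] abscissa_ge[of p k] t by (auto simp: c_def r_def)
  qed
  hence "0 < Min D" using D by simp
  thus "0 < Min D / real r" using r by simp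
  show "max (t - real p) 0 + real (length k - p) * (Min D / real r) \<le>
      (\<Sum>j\<in>{p..<length k}. real (k ! j) - 1)" if p: "p < length k" for p
  proof -
    have "Min D \<le> c p - max (t - real p) 0"
      using D(1) p by (intro Min_le) (auto simp: D_def r_def)
    moreover have "real (r - p) * (Min D / real r) \<le> real r * (Min D / real r)"
      using \<open>0 < Min D\<close> by (intro mult_right_mono) auto
    ultimately show ?thesis using r by (simp add: c_def r_def)
  qed
qed

definition integral_summand :: "nat list \<Rightarrow> nat list \<Rightarrow> complex \<Rightarrow> complex" where
  "integral_summand k n s =
     1 / (\<Prod>j<length k. of_nat (n ! j) ^ (k ! j - 1)) * (LBINT w:{0<..}. ohno_integrand n s w)"

lemma ohno_integrand_integrable:
  assumes n: "n \<in> increasing_tuples r" and s: "- real r < Re s" "Re s < 0"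
  shows "set_integrable lborel {0<..} (ohno_integrand n s)"
proof -
  have "length n = r" using n by (simp add: increasing_tuples_def)
  from ohno_integrand_eq[OF this] have "ohno_integrand n s =
      (\<lambda>w. of_real w powr (- s - 1) * (1 / (\<Prod>j<r. of_real w + of_nat (n ! j))))" by blast
  thus ?thesis
    using mellin_power_decay_integrable[OF continuous_on_inverse_prod_add inverse_prod_add_decay[OF n] s]
    by simp
qed

lemma integral_summand_holomorphic:
  assumes n: "n \<in> increasing_tuples (length k)"
  shows "integral_summand k n holomorphic_on {s. - real (length k) < Re s \<and> Re s < 0}"
proof -
  have "length n = length k" using n by (simp add: increasing_tuples_def)
  from ohno_integrand_eq[OF this] have "integral_summand k n = (\<lambda>s. 1 / (\<Prod>j<length k. of_nat (n ! j) ^ (k ! j - 1)) *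
      (LBINT w:{0<..}. of_real w powr (- s - 1) * (1 / (\<Prod>j<length k. of_real w + of_nat (n ! j)))))"
    by (intro ext) (simp only: integral_summand_def)
  moreover have "(\<lambda>s. LBINT w:{0<..}. of_real w powr (- s - 1) *
      (1 / (\<Prod>j<length k. of_real w + of_nat (n ! j)) :: complex))
      holomorphic_on {s. - real (length k) < Re s \<and> Re s < 0}"
    by (rule mellin_power_decay_holomorphic[OF continuous_on_inverse_prod_add inverse_prod_add_decay[OF n]])
  ultimately show ?thesis by (simp only:) (intro holomorphic_intros)
qed

text \<open>
  The bound of \<open>exponent_shift_bound\<close> is used for two totals with the same \<open>e\<close>: the total \<open>0\<close> gives boundedness
  for \<open>w\<close> near \<open>0\<close>, and a total \<open>t\<close> between \<open>- a\<close> and \<open>- abscissa k\<close> gives integrability at infinity.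
\<close>
lemma integral_summand_majorant:
  assumes k: "admissible k" and ab: "abscissa k < a" "b < 0"
  obtains B where "B summable_on increasing_tuples (length k)"
    "\<And>n s. n \<in> increasing_tuples (length k) \<Longrightarrow> a \<le> Re s \<Longrightarrow> Re s \<le> b \<Longrightarrow>
       norm (integral_summand k n s) \<le> B n"
proof (cases "a \<le> b")
  case False
  show ?thesis by (rule that[of "\<lambda>_. 0"]) (use False in auto)
next
  case True
  hence a0: "a < 0" using ab by simp
  define t where "t = (- abscissa k - a) / 2"
  have t: "0 < t" "- t < a" "t < - abscissa k" "t \<le> real (length k)"
    using a0 ab abscissa_le[OF k] abscissa_ge_minus_length[of k]
    unfolding t_def by (simp_all add: field_simps)
  obtain e where e: "0 < e" "\<And>p. p < length k \<Longrightarrow>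
       max (t - real p) 0 + real (length k - p) * e \<le> (\<Sum>j\<in>{p..<length k}. real (k ! j) - 1)"
    using ex_slack[OF k t(3)] by blast
  define Q where "Q = (\<lambda>n. \<Prod>j<length k. real (n ! j) powr (- (1 + e)))"
  define I where "I = (LBINT w:{0<..}. (w powr (- a - 1) + w powr (- b - 1)) * min 1 (w powr (- t)))"
  show ?thesis
  proof (rule that)
    have "Q summable_on increasing_tuples (length k)"
      unfolding Q_def
      by (rule summable_on_subset_banach[OF summable_on_prod_powr increasing_tuples_subset])
         (use e in simp)
    thus "(\<lambda>n. Q n * I) summable_on increasing_tuples (length k)"
      by (rule summable_on_cmult_left)
    fix n :: "nat list" and s :: complex
    assume n: "n \<in> increasing_tuples (length k)" and s: "a \<le> Re s" "Re s \<le> b"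
    define c where "c = (1 / (\<Prod>j<length k. of_nat (n ! j) ^ (k ! j - 1)) :: complex)"
    define f where "f = (\<lambda>w::real. c * (1 / (\<Prod>j<length k. of_real w + of_nat (n ! j))))"
    have k1: "1 \<le> k ! j" if "j < length k" for j
      using k that by (auto simp: admissible_def)
    have norm_c: "norm c = 1 / (\<Prod>j<length k. real (n ! j) ^ (k ! j - 1))"
      by (simp add: c_def norm_divide norm_power flip: prod_norm)
    have cont: "continuous_on {0<..} f"
      unfolding f_def by (intro continuous_on_mult continuous_on_const continuous_on_inverse_prod_add)
    have bound: "norm (f w) \<le> Q n * min 1 (w powr (- t))" if w: "0 < w" for w
    proof -
      have norm_f: "norm (f w) = 1 / (\<Prod>j<length k. real (n ! j) ^ (k ! j - 1)) *
          (1 / (\<Prod>j<length k. w + real (n ! j)))"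
        unfolding f_def norm_mult norm_c norm_inverse_prod_add[OF w] ..
      have "norm (f w) \<le> w powr (- t) * Q n"
        unfolding norm_f Q_def by (rule exponent_shift_bound[OF n w k1]) (use t e in auto)
      moreover have "norm (f w) \<le> w powr (- 0) * Q n"
        unfolding norm_f Q_def
      proof (rule exponent_shift_bound[OF n w k1])
        show "max (0 - real p) 0 + real (length k - p) * e \<le> (\<Sum>j\<in>{p..<length k}. real (k ! j) - 1)"
          if "p < length k" for p
          using e(2)[OF that] by simp
      qed auto
      ultimately show ?thesis using w by (simp add: min_def mult.commute)
    qed
    have len: "length n = length k" using n by (simp add: increasing_tuples_def)
    have "integral_summand k n s = (LBINT w:{0<..}. of_real w powr (- s - 1) * f w)"
      unfolding integral_summand_def c_def[symmetric] set_integral_mult_right[symmetric]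
      by (simp add: f_def ohno_integrand_eq[OF len] mult_ac)
    thus "norm (integral_summand k n s) \<le> Q n * I"
      using mellin_power_decay_norm_le[OF cont bound t(2) s ab(2)] by (simp add: I_def)
  qed
qed

lemma integral_summand_summable:
  assumes "admissible k" "abscissa k < Re s" "Re s < 0"
  shows "(\<lambda>n. integral_summand k n s) summable_on increasing_tuples (length k)"
proof -
  obtain B where B: "B summable_on increasing_tuples (length k)"
    "\<And>n z. n \<in> increasing_tuples (length k) \<Longrightarrow> Re s \<le> Re z \<Longrightarrow> Re z \<le> Re s \<Longrightarrow>
       norm (integral_summand k n z) \<le> B n"
    using integral_summand_majorant[OF assms] by blast
  show ?thesis
    by (rule abs_summable_summable, rule summable_on_comparison_test[OF B(1)]) (use B(2) in auto)
qed

lemma integral_sum_holomorphic: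
  assumes k: "admissible k"
  shows "(\<lambda>s. \<Sum>\<^sub>\<infinity>n\<in>increasing_tuples (length k). integral_summand k n s)
    holomorphic_on {s. abscissa k < Re s \<and> Re s < 0}"
proof (rule holomorphic_on_strip)
  fix a b :: real assume ab: "abscissa k < a" "a < b" "b < 0"
  obtain B where B: "B summable_on increasing_tuples (length k)"
    "\<And>n s. n \<in> increasing_tuples (length k) \<Longrightarrow> a \<le> Re s \<Longrightarrow> Re s \<le> b \<Longrightarrow>
       norm (integral_summand k n s) \<le> B n"
    using integral_summand_majorant[OF k ab(1,3)] by blast
  show "(\<lambda>s. \<Sum>\<^sub>\<infinity>n\<in>increasing_tuples (length k). integral_summand k n s)
      holomorphic_on {s. a < Re s \<and> Re s < b}"
  proof (rule holomorphic_on_infsum[OF open_strip _ _ B(1)])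
    fix n assume "n \<in> increasing_tuples (length k)"
    thus "integral_summand k n holomorphic_on {s. a < Re s \<and> Re s < b}"
      by (rule holomorphic_on_subset[OF integral_summand_holomorphic])
         (use ab abscissa_ge_minus_length[of k] in auto)
  qed (use B(2) in auto)
qed

section \<open>The continuation of the Ohno function\<close>

lemma ohno_series_eq_integral_sum:
  assumes k: "admissible k" and s: "- 1 < Re s" "Re s < 0"
  shows "ohno_series k s = - (sin (of_real pi * s) / of_real pi) *
    (\<Sum>\<^sub>\<infinity>n\<in>increasing_tuples (length k). integral_summand k n s)"
proof -
  have k1: "1 \<le> k ! j" if "j < length k" for j
    using k that by (auto simp: admissible_def)
  have k0: "0 < length k" using k by (auto simp: admissible_def)
  have "ohno_series k s =
      (\<Sum>i<length k. \<Sum>\<^sub>\<infinity>n\<in>increasing_tuples (length k). ohno_summand k i n s)"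
    by (rule ohno_series_eq[OF k1])
  also have "\<dots> = (\<Sum>\<^sub>\<infinity>n\<in>increasing_tuples (length k). \<Sum>i<length k. ohno_summand k i n s)"
    by (rule infsumI[OF has_sum_finite_sum, symmetric])
       (use ohno_summand_summable[OF k _ s(1)] in auto)
  also have "\<dots> = (\<Sum>\<^sub>\<infinity>n\<in>increasing_tuples (length k).
      - (sin (of_real pi * s) / of_real pi) * integral_summand k n s)"
  proof (rule infsum_cong)
    fix n assume n: "n \<in> increasing_tuples (length k)"
    have "a * (c * d) = c * (a * d)" for a c d :: complex by simp
    thus "(\<Sum>i<length k. ohno_summand k i n s) =
        - (sin (of_real pi * s) / of_real pi) * integral_summand k n s"
      unfolding ohno_summand_def integral_summand_def sum_distrib_left[symmetric]
        ohno_integral_partial_fractions[OF n k0 s, symmetric] by (simp only:)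
  qed
  also have "\<dots> = - (sin (of_real pi * s) / of_real pi) *
      (\<Sum>\<^sub>\<infinity>n\<in>increasing_tuples (length k). integral_summand k n s)"
    by (rule infsum_cmult_right) (use integral_summand_summable[OF k] abscissa_le[OF k] s in auto)
  finally show ?thesis .
qed

text \<open>
  Since \<open>abscissa k \<le> -1\<close>, the half-plane of the series and the strip of the integrals cover the
  half-plane \<open>Re s > abscissa k\<close>; they overlap in \<open>-1 < Re s < 0\<close>, where both expressions agree.
\<close>
lemma ohno_function_eq_integral_sum:
  assumes k: "admissible k" and s: "abscissa k < Re s" "Re s < 0"
  shows "ohno_function k s = - (sin (of_real pi * s) / of_real pi) *
    (\<Sum>\<^sub>\<infinity>n\<in>increasing_tuples (length k). integral_summand k n s)"
proof -
  define H where "H = (\<lambda>s. - (sin (of_real pi * s) / of_real pi) *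
    (\<Sum>\<^sub>\<infinity>n\<in>increasing_tuples (length k). integral_summand k n s))"
  define F where "F = (\<lambda>s. if - 1 < Re s then ohno_series k s else H s)"
  define U where "U = {s. - 1 < Re s}"
  define V where "V = {s. abscissa k < Re s \<and> Re s < 0}"
  have FU: "F holomorphic_on U"
    using ohno_series_holomorphic[OF k] unfolding U_def
    by (rule holomorphic_transform) (simp add: F_def)
  have "H holomorphic_on V"
    unfolding H_def V_def by (intro holomorphic_intros integral_sum_holomorphic[OF k]) auto
  hence FV: "F holomorphic_on V"
    by (rule holomorphic_transform)
       (use ohno_series_eq_integral_sum[OF k] in \<open>auto simp: V_def F_def H_def\<close>)
  have "F holomorphic_on U \<union> V"
    using FU FV by (rule holomorphic_on_Un) (auto simp: U_def V_def open_halfspace_Re_gt open_strip)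
  moreover have UV: "U \<union> V = {s. abscissa k < Re s}"
    using abscissa_le[OF k] by (auto simp: U_def V_def)
  ultimately have "F analytic_on {s. abscissa k < Re s}"
    by (simp add: analytic_on_open open_halfspace_Re_gt)
  hence "ohno_continuation k (abscissa k) F"
    using abscissa_le[OF k]
    by (auto simp: ohno_continuation_def F_def intro: analytic_on_imp_nicely_meromorphic_on)
  hence "ohno_function k s = F s" using s(1) by (rule ohno_function_eq)
  also have "\<dots> = H s"
    using ohno_series_eq_integral_sum[OF k _ s(2)] by (simp add: F_def H_def)
  finally show ?thesis by (simp add: H_def)
qed

theorem theorem1p6:
  fixes k :: "nat list" and s :: complex
  assumes "admissible k"
    and "(MAX j\<in>{1..length k}.
            real (length k) - 2 * real j + 2 - (\<Sum>i=j..length k. real (k ! (i - 1)))) < Re s"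
    and "- real (length k) < Re s"
    and "Re s < 0"
  shows "(\<forall>n\<in>increasing_tuples (length k). set_integrable lborel {0<..} (ohno_integrand n s)) \<and>
         (\<lambda>n. 1 / (\<Prod>j<length k. of_nat (n ! j) ^ (k ! j - 1)) *
              (LBINT w:{0<..}. ohno_integrand n s w)) summable_on increasing_tuples (length k) \<and>
         ohno_function k s =
           - (sin (of_real pi * s) / of_real pi) *
           (\<Sum>\<^sub>\<infinity>n\<in>increasing_tuples (length k).
              1 / (\<Prod>j<length k. of_nat (n ! j) ^ (k ! j - 1)) *
              (LBINT w:{0<..}. ohno_integrand n s w))"
proof -
  have s: "abscissa k < Re s" using assms(2,3) by (simp add: abscissa_def)
  show ?thesis
    using ohno_integrand_integrable[OF _ assms(3,4)]
      integral_summand_summable[OF assms(1) s assms(4)]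
      ohno_function_eq_integral_sum[OF assms(1) s assms(4)]
    by (simp add: integral_summand_def)
qed

end
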